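(* Let $p$ be an odd prime, $n\ge 1$, $K$ a field of characteristic $p$, $Q=C_{p^n}=\langle\sigma\rangle$ a cyclic group of order $p^n$, $M$ a finite group and $G=Q\ltimes M$ a split extension. Let $V$ be a $KG$-module with trivial $M$-action, let $P_\bullet\to K$ be the minimal projective $KM$-resolution of the trivial module $K$, and let $E$ be the Lyndon-Hochschild-Serre spectral sequence $E_2^{r,s}=H^r(Q;H^s(M;V))\Rightarrow H^{r+s}(G;V)$. Let $\alpha\colon P_\bullet\to P_\bullet^{\sigma^{-1}}$ be a $KM$-chain map commuting with the augmentation, and let $\tau\in \mathrm{Hom}_{KM}(P_\bullet,P_\bullet)_1$ be such that $\partial\tau+\tau\partial=1-\alpha^{p^n}$. Suppose that $\zeta\in E_2^{r,s}$, with $r\geq 0$ and $s\geq 1$, is represented by $f\in\mathrm{Hom}_{KM}(P_s,V)$. Then $d_2(\zeta)\in E_2^{r+2,s-1}$ is represented by $(-1)^r f\circ\tau$.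
   Context: For $g\in Q$, $P_\bullet^g$ denotes the $KM$-complex with underlying $K$-complex $P_\bullet$ and $M$-action given by $h\cdot x=h^{g^{-1}}x$ for $h\in M$, $x\in P_\bullet$, where $h^{g}=g^{-1}hg$ and the right-hand side uses the original action on $P_\bullet$. Thus $\alpha$ is a $K$-chain map $P_\bullet\to P_\bullet$ with $\alpha(hx)=h^{\sigma}\alpha(x)$, and $\alpha^{p^n}\colon P_\bullet\to P_\bullet$ is $KM$-linear. $\mathrm{Hom}_{KM}(P_\bullet,P_\bullet)_i$ denotes the $KM$-linear maps of degree $i$, i.e. $\prod_{k\ge 0}\mathrm{Hom}_{KM}(P_k,P_{k+i})$. Representatives: let $Z_\bullet\to K$ be the minimal $KQ$-resolution, $Z_k=KQ\,e_k$, with $\partial e_{2k+1}=(\sigma-1)e_{2k}$ and $\partial e_{2k}=\sum_{i=0}^{p^n-1}\sigma^i e_{2k-1}$. The first page is identified with $E_1=\mathrm{Hom}_{KQ}(Z_\bullet,\mathrm{Hom}_{KM}(P_\bullet,V))$, where (since $P_\bullet$ is minimal and $M$ acts trivially on $V$) $\mathrm{Hom}_{KM}(P_s,V)$ is identified with $H^s(M;V)$ with its natural $Q$-action. A class $\zeta\in E_2^{r,s}$ is represented by $f\in\mathrm{Hom}_{KM}(P_s,V)$ if it is the class of the cocycle $Z_r\to \mathrm{Hom}_{KM}(P_s,V)$ sending $e_r$ to $f$. *)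

theory Defs
  imports
    Complex_Main
    "HOL-Algebra.Generated_Groups"
    "HOL-Computational_Algebra.Primes"
    "HOL-Library.Function_Algebras"
    "HOL-Library.Set_Algebras"
begin

abbreviation subgrp :: "('g, 'b) monoid_scheme \<Rightarrow> 'g set \<Rightarrow> ('g, 'b) monoid_scheme"
  where "subgrp G H \<equiv> G\<lparr>carrier := H\<rparr>"

section \<open>Modules over group algebras\<close>

text \<open>A module over the group algebra of H is a K-vector space with a K-linear action of H. The
  vector space is a subspace of an ambient vector space on a type, so that all terms of
  a complex can live in one type. The acting group is an argument of the predicates and not part
  of the record; restriction to a subgroup leaves the record unchanged.\<close>

record ('k, 'g, 'x) kmod =
  mcarrier :: "'x set"
  mscale :: "'k \<Rightarrow> 'x \<Rightarrow> 'x"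
  maction :: "'g \<Rightarrow> 'x \<Rightarrow> 'x"

definition is_kmod :: "('g, 'b) monoid_scheme \<Rightarrow> ('k::field, 'g, 'x::ab_group_add) kmod \<Rightarrow> bool"
  where "is_kmod H A \<longleftrightarrow>
    vector_space (mscale A) \<and>
    module.subspace (mscale A) (mcarrier A) \<and>
    (\<forall>h\<in>carrier H. \<forall>x\<in>mcarrier A. maction A h x \<in> mcarrier A) \<and>
    (\<forall>h\<in>carrier H. \<forall>x\<in>mcarrier A. \<forall>y\<in>mcarrier A.
        maction A h (x + y) = maction A h x + maction A h y) \<and>
    (\<forall>h\<in>carrier H. \<forall>c. \<forall>x\<in>mcarrier A.
        maction A h (mscale A c x) = mscale A c (maction A h x)) \<and>
    (\<forall>x\<in>mcarrier A. maction A \<one>\<^bsub>H\<^esub> x = x) \<and>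
    (\<forall>g\<in>carrier H. \<forall>h\<in>carrier H. \<forall>x\<in>mcarrier A.
        maction A (g \<otimes>\<^bsub>H\<^esub> h) x = maction A g (maction A h x))"

definition submod ::
    "('g, 'b) monoid_scheme \<Rightarrow> ('k::field, 'g, 'x::ab_group_add) kmod \<Rightarrow> 'x set \<Rightarrow> bool"
  where "submod H A U \<longleftrightarrow>
    U \<subseteq> mcarrier A \<and> module.subspace (mscale A) U \<and>
    (\<forall>h\<in>carrier H. \<forall>x\<in>U. maction A h x \<in> U)"

text \<open>Homomorphisms are normalised to vanish outside the carrier of their domain, so that equality of
  homomorphisms is equality of functions and the homomorphisms form a subspace for the
  pointwise operations.\<close>

definition khom :: "('g, 'b) monoid_scheme \<Rightarrow> ('k::field, 'g, 'x::ab_group_add) kmod \<Rightarrow>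
    ('k, 'g, 'y::ab_group_add) kmod \<Rightarrow> ('x \<Rightarrow> 'y) set"
  where "khom H A B = {f.
    (\<forall>x\<in>mcarrier A. f x \<in> mcarrier B) \<and>
    (\<forall>x\<in>mcarrier A. \<forall>y\<in>mcarrier A. f (x + y) = f x + f y) \<and>
    (\<forall>c. \<forall>x\<in>mcarrier A. f (mscale A c x) = mscale B c (f x)) \<and>
    (\<forall>h\<in>carrier H. \<forall>x\<in>mcarrier A. f (maction A h x) = maction B h (f x)) \<and>
    (\<forall>x. x \<notin> mcarrier A \<longrightarrow> f x = 0)}"

definition trivial_kmod :: "('k::field, 'g, 'k) kmod"
  where "trivial_kmod = \<lparr>mcarrier = UNIV, mscale = (*), maction = (\<lambda>g x. x)\<rparr>"

text \<open>The free module on I: finitely supported functions on pairs, the pair (i, h)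
  standing for the element h of the group in the i-th copy of the group algebra.\<close>

definition free_kmod :: "('g, 'b) monoid_scheme \<Rightarrow> 'i set \<Rightarrow> ('k::field, 'g, 'i \<times> 'g \<Rightarrow> 'k) kmod"
  where "free_kmod H I =
    \<lparr>mcarrier = {\<phi>. finite {z. \<phi> z \<noteq> 0} \<and> {z. \<phi> z \<noteq> 0} \<subseteq> I \<times> carrier H},
     mscale = (\<lambda>c \<phi> z. c * \<phi> z),
     maction = (\<lambda>g \<phi> (i, h). if h \<in> carrier H then \<phi> (i, inv\<^bsub>H\<^esub> g \<otimes>\<^bsub>H\<^esub> h) else 0)\<rparr>"

text \<open>Projective means direct summand of a free module. Index sets in the element type of the module
  are enough, since every module is a quotient of the free module on its own carrier.\<close>

definition projective_kmod :: "('g, 'b) monoid_scheme \<Rightarrow> ('k::field, 'g, 'x::ab_group_add) kmod \<Rightarrow> bool"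
  where "projective_kmod H A \<longleftrightarrow> is_kmod H A \<and>
    (\<exists>(I::'x set) \<iota> \<pi>. \<iota> \<in> khom H A (free_kmod H I) \<and> \<pi> \<in> khom H (free_kmod H I) A \<and>
        (\<forall>x\<in>mcarrier A. \<pi> (\<iota> x) = x))"

definition superfluous ::
    "('g, 'b) monoid_scheme \<Rightarrow> ('k::field, 'g, 'x::ab_group_add) kmod \<Rightarrow> 'x set \<Rightarrow> bool"
  where "superfluous H A N \<longleftrightarrow>
    submod H A N \<and> (\<forall>U. submod H A U \<and> N + U = mcarrier A \<longrightarrow> U = mcarrier A)"

section \<open>Complexes and resolutions\<close>

text \<open>In a chain complex (A, d) the map d k is the differential from degree k to degree
  k - 1; d 0 is the zero map on degree 0.\<close>

definition chain_complex :: "('g, 'b) monoid_scheme \<Rightarrow>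
    (nat \<Rightarrow> ('k::field, 'g, 'x::ab_group_add) kmod) \<Rightarrow> (nat \<Rightarrow> 'x \<Rightarrow> 'x) \<Rightarrow> bool"
  where "chain_complex H A d \<longleftrightarrow>
    (\<forall>k. is_kmod H (A k)) \<and> d 0 = 0 \<and>
    (\<forall>k. d (Suc k) \<in> khom H (A (Suc k)) (A k)) \<and>
    (\<forall>k. \<forall>x\<in>mcarrier (A (Suc k)). d k (d (Suc k) x) = 0)"

definition chain_map :: "('g, 'b) monoid_scheme \<Rightarrow>
    (nat \<Rightarrow> ('k::field, 'g, 'x::ab_group_add) kmod) \<Rightarrow> (nat \<Rightarrow> 'x \<Rightarrow> 'x) \<Rightarrow>
    (nat \<Rightarrow> ('k, 'g, 'y::ab_group_add) kmod) \<Rightarrow> (nat \<Rightarrow> 'y \<Rightarrow> 'y) \<Rightarrow> (nat \<Rightarrow> 'x \<Rightarrow> 'y) \<Rightarrow> bool"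
  where "chain_map H A dA B dB f \<longleftrightarrow>
    (\<forall>k. f k \<in> khom H (A k) (B k)) \<and>
    (\<forall>k. \<forall>x\<in>mcarrier (A (Suc k)). dB (Suc k) (f (Suc k) x) = f k (dA (Suc k) x))"

definition projective_resolution :: "('g, 'b) monoid_scheme \<Rightarrow>
    (nat \<Rightarrow> ('k::field, 'g, 'x::ab_group_add) kmod) \<Rightarrow> (nat \<Rightarrow> 'x \<Rightarrow> 'x) \<Rightarrow> ('x \<Rightarrow> 'k) \<Rightarrow> bool"
  where "projective_resolution H A d \<epsilon> \<longleftrightarrow>
    chain_complex H A d \<and> (\<forall>k. projective_kmod H (A k)) \<and>
    \<epsilon> \<in> khom H (A 0) trivial_kmod \<and>
    \<epsilon> ` mcarrier (A 0) = UNIV \<and>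
    d 1 ` mcarrier (A 1) = {x \<in> mcarrier (A 0). \<epsilon> x = 0} \<and>
    (\<forall>k\<ge>1. d (Suc k) ` mcarrier (A (Suc k)) = {x \<in> mcarrier (A k). d k x = 0})"

text \<open>Minimality: every term is a projective cover of its image under the differential (under the
  augmentation in degree 0), that is, the kernels are superfluous submodules.\<close>

definition minimal_projective_resolution :: "('g, 'b) monoid_scheme \<Rightarrow>
    (nat \<Rightarrow> ('k::field, 'g, 'x::ab_group_add) kmod) \<Rightarrow> (nat \<Rightarrow> 'x \<Rightarrow> 'x) \<Rightarrow> ('x \<Rightarrow> 'k) \<Rightarrow> bool"
  where "minimal_projective_resolution H A d \<epsilon> \<longleftrightarrow>
    projective_resolution H A d \<epsilon> \<and>
    superfluous H (A 0) {x \<in> mcarrier (A 0). \<epsilon> x = 0} \<and>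
    (\<forall>k\<ge>1. superfluous H (A k) {x \<in> mcarrier (A k). d k x = 0})"

text \<open>The twist by g: h acts as the conjugate of h by the inverse of g, where conjugation is a right
  action, so as g h (inv g). The differential of a twisted complex is unchanged.\<close>

definition twist :: "('g, 'b) monoid_scheme \<Rightarrow> 'g \<Rightarrow> ('k, 'g, 'x) kmod \<Rightarrow> ('k, 'g, 'x) kmod"
  where "twist G g A = A\<lparr>maction := (\<lambda>h. maction A (g \<otimes>\<^bsub>G\<^esub> h \<otimes>\<^bsub>G\<^esub> inv\<^bsub>G\<^esub> g))\<rparr>"

section \<open>The spectral sequence of a filtered cochain complex\<close>

text \<open>F r n is the r-th step of a decreasing filtration in degree n and d n is the differential from
  degree n to degree n + 1. The page k at (r, s), of total degree r + s, is the quotient of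
  the group of cycles by the group of bounds, as a set of cosets.\<close>

definition ss_cycles ::
    "(int \<Rightarrow> int \<Rightarrow> 'a::ab_group_add set) \<Rightarrow> (int \<Rightarrow> 'a \<Rightarrow> 'a) \<Rightarrow> int \<Rightarrow> int \<Rightarrow> int \<Rightarrow> 'a set"
  where "ss_cycles F d k r s = {x \<in> F r (r + s). d (r + s) x \<in> F (r + k) (r + s + 1)}"

definition ss_bounds ::
    "(int \<Rightarrow> int \<Rightarrow> 'a::ab_group_add set) \<Rightarrow> (int \<Rightarrow> 'a \<Rightarrow> 'a) \<Rightarrow> int \<Rightarrow> int \<Rightarrow> int \<Rightarrow> 'a set"
  where "ss_bounds F d k r s =
    ss_cycles F d (k - 1) (r + 1) (s - 1) +
    d (r + s - 1) ` ss_cycles F d (k - 1) (r - k + 1) (s + k - 2)"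

definition ss_page ::
    "(int \<Rightarrow> int \<Rightarrow> 'a::ab_group_add set) \<Rightarrow> (int \<Rightarrow> 'a \<Rightarrow> 'a) \<Rightarrow> int \<Rightarrow> int \<Rightarrow> int \<Rightarrow> 'a set set"
  where "ss_page F d k r s = (\<lambda>x. x +o ss_bounds F d k r s) ` ss_cycles F d k r s"

text \<open>The differential from (r, s) to (r + k, s - k + 1) sends the class of x to the class of d x; the
  cosets in the union all coincide.\<close>

definition ss_diff ::
    "(int \<Rightarrow> int \<Rightarrow> 'a::ab_group_add set) \<Rightarrow> (int \<Rightarrow> 'a \<Rightarrow> 'a) \<Rightarrow> int \<Rightarrow> int \<Rightarrow> int \<Rightarrow> 'a set \<Rightarrow> 'a set"
  where "ss_diff F d k r s \<zeta> = (\<Union>x\<in>\<zeta>. d (r + s) x +o ss_bounds F d k (r + k) (s - k + 1))"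

section \<open>The minimal resolution for the cyclic quotient\<close>

text \<open>Every term of the resolution is a free module of rank one with generator e.\<close>

abbreviation cyc_mod :: "('g, 'b) monoid_scheme \<Rightarrow> 'g \<Rightarrow> ('k::field, 'g, unit \<times> 'g \<Rightarrow> 'k) kmod"
  where "cyc_mod G \<sigma> \<equiv> free_kmod (subgrp G (generate G {\<sigma>})) {()}"

definition cyc_gen :: "('g, 'b) monoid_scheme \<Rightarrow> unit \<times> 'g \<Rightarrow> 'k::field"
  where "cyc_gen G = (\<lambda>(i, h). if h = \<one>\<^bsub>G\<^esub> then 1 else 0)"

text \<open>The linear map with value (\<sigma> - 1) e, respectively the sum of the \<sigma>^i e, at the generator is
  multiplication by that element of the group algebra, the group algebra being commutative.\<close>

definition cyc_diff :: "('g, 'b) monoid_scheme \<Rightarrow> 'g \<Rightarrow> nat \<Rightarrow> (unit \<times> 'g \<Rightarrow> 'k::field) \<Rightarrow> unit \<times> 'g \<Rightarrow> 'k"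
  where "cyc_diff G \<sigma> k \<phi> =
    (if k = 0 \<or> \<phi> \<notin> mcarrier (cyc_mod G \<sigma> :: ('k, 'g, _) kmod) then 0
     else if odd k then maction (cyc_mod G \<sigma>) \<sigma> \<phi> - \<phi>
     else (\<Sum>i<card (generate G {\<sigma>}). maction (cyc_mod G \<sigma>) (\<sigma> [^]\<^bsub>G\<^esub> i) \<phi>))"

section \<open>The Lyndon-Hochschild-Serre spectral sequence\<close>

text \<open>The M-homomorphisms between G-modules, with the conjugation action of G. It is used as a
  module over a complement of M.\<close>

definition hom_kmod :: "('g, 'b) monoid_scheme \<Rightarrow> 'g set \<Rightarrow> ('k::field, 'g, 'y::ab_group_add) kmod \<Rightarrow>
    ('k, 'g, 'v::ab_group_add) kmod \<Rightarrow> ('k, 'g, 'y \<Rightarrow> 'v) kmod"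
  where "hom_kmod G M Y V =
    \<lparr>mcarrier = khom (subgrp G M) Y V,
     mscale = (\<lambda>c f y. mscale V c (f y)),
     maction = (\<lambda>g f y. if y \<in> mcarrier Y
        then maction V g (f (maction Y (inv\<^bsub>G\<^esub> g) y)) else 0)\<rparr>"

text \<open>Y is a projective resolution of the trivial module over the whole group. The double complex
  has the entry Hom_Q (Z_i, Hom_M (Y_j, V)) at (i, j), where Q is generated by \<sigma>. A cochain of total
  degree n is the family x of its components, x i having bidegree (i, n - i).\<close>

definition lhs_entry :: "('g, 'b) monoid_scheme \<Rightarrow> 'g set \<Rightarrow> 'g \<Rightarrow>
    (nat \<Rightarrow> ('k::field, 'g, 'y::ab_group_add) kmod) \<Rightarrow> ('k, 'g, 'v::ab_group_add) kmod \<Rightarrow>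
    nat \<Rightarrow> ((unit \<times> 'g \<Rightarrow> 'k) \<Rightarrow> 'y \<Rightarrow> 'v) set"
  where "lhs_entry G M \<sigma> Y V j =
    khom (subgrp G (generate G {\<sigma>})) (cyc_mod G \<sigma>) (hom_kmod G M (Y j) V)"

definition lhs_filtration :: "('g, 'b) monoid_scheme \<Rightarrow> 'g set \<Rightarrow> 'g \<Rightarrow>
    (nat \<Rightarrow> ('k::field, 'g, 'y::ab_group_add) kmod) \<Rightarrow> ('k, 'g, 'v::ab_group_add) kmod \<Rightarrow>
    int \<Rightarrow> int \<Rightarrow> (nat \<Rightarrow> (unit \<times> 'g \<Rightarrow> 'k) \<Rightarrow> 'y \<Rightarrow> 'v) set"
  where "lhs_filtration G M \<sigma> Y V r n = {x. \<forall>i.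
    (int i \<le> n \<longrightarrow> x i \<in> lhs_entry G M \<sigma> Y V (nat (n - int i))) \<and>
    (int i > n \<longrightarrow> x i = 0) \<and>
    (int i < r \<longrightarrow> x i = 0)}"

text \<open>The total differential is the horizontal differential plus (-1)^i times the vertical one in the
  column i, both given by precomposition without further signs.\<close>

definition lhs_diff :: "('g, 'b) monoid_scheme \<Rightarrow> 'g \<Rightarrow>
    (nat \<Rightarrow> 'y::ab_group_add \<Rightarrow> 'y) \<Rightarrow> ('k::field, 'g, 'v::ab_group_add) kmod \<Rightarrow>
    int \<Rightarrow> (nat \<Rightarrow> (unit \<times> 'g \<Rightarrow> 'k) \<Rightarrow> 'y \<Rightarrow> 'v) \<Rightarrow> (nat \<Rightarrow> (unit \<times> 'g \<Rightarrow> 'k) \<Rightarrow> 'y \<Rightarrow> 'v)"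
  where "lhs_diff G \<sigma> dY V n x = (\<lambda>i \<phi> y.
    (if i = 0 then 0 else x (i - 1) (cyc_diff G \<sigma> i \<phi>) y) +
    mscale V ((-1) ^ i) (x i \<phi> (dY (nat (n - int i) + 1) y)))"

abbreviation lhs_page :: "('g, 'b) monoid_scheme \<Rightarrow> 'g set \<Rightarrow> 'g \<Rightarrow>
    (nat \<Rightarrow> ('k::field, 'g, 'y::ab_group_add) kmod) \<Rightarrow> (nat \<Rightarrow> 'y \<Rightarrow> 'y) \<Rightarrow>
    ('k, 'g, 'v::ab_group_add) kmod \<Rightarrow> int \<Rightarrow> int \<Rightarrow> int \<Rightarrow>
    (nat \<Rightarrow> (unit \<times> 'g \<Rightarrow> 'k) \<Rightarrow> 'y \<Rightarrow> 'v) set set"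
  where "lhs_page G M \<sigma> Y dY V \<equiv> ss_page (lhs_filtration G M \<sigma> Y V) (lhs_diff G \<sigma> dY V)"

abbreviation lhs_page_diff :: "('g, 'b) monoid_scheme \<Rightarrow> 'g set \<Rightarrow> 'g \<Rightarrow>
    (nat \<Rightarrow> ('k::field, 'g, 'y::ab_group_add) kmod) \<Rightarrow> (nat \<Rightarrow> 'y \<Rightarrow> 'y) \<Rightarrow>
    ('k, 'g, 'v::ab_group_add) kmod \<Rightarrow> int \<Rightarrow> int \<Rightarrow> int \<Rightarrow>
    (nat \<Rightarrow> (unit \<times> 'g \<Rightarrow> 'k) \<Rightarrow> 'y \<Rightarrow> 'v) set \<Rightarrow> (nat \<Rightarrow> (unit \<times> 'g \<Rightarrow> 'k) \<Rightarrow> 'y \<Rightarrow> 'v) set"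
  where "lhs_page_diff G M \<sigma> Y dY V \<equiv> ss_diff (lhs_filtration G M \<sigma> Y V) (lhs_diff G \<sigma> dY V)"

text \<open>Let P be the minimal resolution over M and \<theta> a comparison map from P to Y over M. A class in the
  first page at (r, s) is given by a homomorphism from Z_r to the cohomology of Hom_M (Y, V) in
  degree s. As M acts trivially on V and P is minimal, Hom_M (P, V) has zero differential, and
  precomposition with \<theta> identifies this cohomology with Hom_M (P_s, V). Hence x in a class \<zeta> of the
  second page has the class in the first page given by the cocycle sending the element \<phi> of Z_r to
  x r \<phi> composed with \<theta> s, and \<zeta> is represented by f if this cocycle sends the generator to f for
  some x in \<zeta>.\<close>

definition represented_by :: "('g, 'b) monoid_scheme \<Rightarrow> 'g set \<Rightarrow>
    (nat \<Rightarrow> ('k::field, 'g, 'x::ab_group_add) kmod) \<Rightarrow> ('k, 'g, 'v::ab_group_add) kmod \<Rightarrow>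
    (nat \<Rightarrow> 'x \<Rightarrow> 'y::ab_group_add) \<Rightarrow> nat \<Rightarrow> nat \<Rightarrow>
    (nat \<Rightarrow> (unit \<times> 'g \<Rightarrow> 'k) \<Rightarrow> 'y \<Rightarrow> 'v) set \<Rightarrow> ('x \<Rightarrow> 'v) \<Rightarrow> bool"
  where "represented_by G M P V \<theta> r s \<zeta> f \<longleftrightarrow>
    f \<in> khom (subgrp G M) (P s) V \<and> (\<exists>x\<in>\<zeta>. x r (cyc_gen G) \<circ> \<theta> s = f)"

end

(*
Over the double complex Hom_Q(Z, Hom_M(Y, V)) write T for the action of \<sigma> on Hom_M(Y, V), q for the
order of \<sigma>, and N for the sum of the powers T^i with i < q. A class represented at (r, s) by a cocycle
a in Hom_M(Y_s, V) comes with some b in Hom_M(Y_{s-1}, V) such that b d = (T - 1) a for r even and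
b d = - N a for r odd, and d_2 is given by N b, respectively (T - 1) b, restricted along \<theta>. By
minimality every M-map from P to the trivial module V kills boundaries, so only homotopy classes
matter after composing with V.

Since \<theta> \<alpha> and \<sigma>^{-1} \<theta> are both twisted comparison maps, there is a twisted homotopy \<kappa> between
them. Telescoping produces homotopies K_m from \<sigma>^{-m} \<theta> to \<theta> \<alpha>^m with
K_{m+1} = K_m \<alpha> + \<sigma>^{-m} \<kappa>. For m = q the map \<theta> \<tau> + K_q anticommutes with the differentials, hence is
null-homotopic, and so a \<theta> \<tau> = - a K_q. With R_m = \<sigma>^m a K_m and W_m = \<sigma>^{m+1} a \<sigma>^{-m} \<kappa> one has
R_{m+1} = \<sigma> R_m \<alpha> + W_m. As restriction along \<theta> is onto on cohomology, b may be changed by a cocycle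
so that b \<theta> = - W_0 for r even, and b \<theta> is the sum of the R_i with i < q for r odd. In the even case
(T^i b) \<theta> = R_i - R_{i+1}; in both cases a telescoping sum leaves (N b) \<theta> = - R_q, respectively
((T - 1) b) \<theta> = R_q, where R_q = - a \<theta> \<tau>.
*)

theory Submission
  imports Defs "HOL-Algebra.Multiplicative_Group"
begin

section \<open>Modules and homomorphisms\<close>

text \<open>The obstacle is that \<sigma> acts on \<open>Y\<close> but not on \<open>P\<close>:
  \<alpha> is only semilinear, and \<alpha>^q is only homotopic to the identity, through \<tau>. So
  the double complex is built on \<open>Y\<close>, and information on \<open>P\<close> travels along
  \<theta> by maps twisted by powers of \<sigma>. Composition with a map into V removes the twist,
  as M acts trivially there; homotopies with different twists thus become M-homomorphisms into V
  that can be added. The map \<theta> \<tau> + K_q anticommutes because K_q joins \<theta> to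
  \<theta> \<alpha>^q, using \<sigma>^q = 1, and \<theta> \<tau> leads back. This loop is
  null-homotopic because it maps projectives into the part of Y in positive degrees, which is exact.
  Minimality makes every term h d vanish when h maps into V, so the identities after restriction
  along \<theta> hold for cochains and not merely up to coboundary. The sign (-1)^r is that of the
  vertical differential: the vanishing of column r + 1 of the differential reads b d = (-1)^r D a,
  with D = T - 1 or D = N.\<close>

lemma kmod_vs: "is_kmod H A \<Longrightarrow> vector_space (mscale A)"
  and kmod_subspace: "is_kmod H A \<Longrightarrow> Modules.module.subspace (mscale A) (mcarrier A)"
  and kmod_act: "is_kmod H A \<Longrightarrow> h \<in> carrier H \<Longrightarrow> x \<in> mcarrier A \<Longrightarrow> maction A h x \<in> mcarrier A"
  and kmod_act_add: "is_kmod H A \<Longrightarrow> h \<in> carrier H \<Longrightarrow> x \<in> mcarrier A \<Longrightarrow> y \<in> mcarrier A \<Longrightarrow>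
    maction A h (x + y) = maction A h x + maction A h y"
  and kmod_act_scale: "is_kmod H A \<Longrightarrow> h \<in> carrier H \<Longrightarrow> x \<in> mcarrier A \<Longrightarrow>
    maction A h (mscale A c x) = mscale A c (maction A h x)"
  and kmod_act_one: "is_kmod H A \<Longrightarrow> x \<in> mcarrier A \<Longrightarrow> maction A \<one>\<^bsub>H\<^esub> x = x"
  and kmod_act_mult: "is_kmod H A \<Longrightarrow> g \<in> carrier H \<Longrightarrow> h \<in> carrier H \<Longrightarrow> x \<in> mcarrier A \<Longrightarrow>
    maction A (g \<otimes>\<^bsub>H\<^esub> h) x = maction A g (maction A h x)"
  by (simp_all add: is_kmod_def)

lemma kmod_module: "is_kmod H A \<Longrightarrow> Modules.module (mscale A)"
  by (simp add: kmod_vs module_iff_vector_space)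

lemma kmod_zero: "is_kmod H A \<Longrightarrow> 0 \<in> mcarrier A"
  using Modules.module.subspace_0 kmod_module kmod_subspace by blast

lemma kmod_add: "is_kmod H A \<Longrightarrow> x \<in> mcarrier A \<Longrightarrow> y \<in> mcarrier A \<Longrightarrow> x + y \<in> mcarrier A"
  using Modules.module.subspace_add kmod_module kmod_subspace by blast

lemma kmod_diff: "is_kmod H A \<Longrightarrow> x \<in> mcarrier A \<Longrightarrow> y \<in> mcarrier A \<Longrightarrow> x - y \<in> mcarrier A"
  using Modules.module.subspace_diff kmod_module kmod_subspace by blast

lemma kmod_scale: "is_kmod H A \<Longrightarrow> x \<in> mcarrier A \<Longrightarrow> mscale A c x \<in> mcarrier A"
  using Modules.module.subspace_scale kmod_module kmod_subspace by blast

lemma kmod_sum: "is_kmod H A \<Longrightarrow> (\<And>i. i \<in> I \<Longrightarrow> f i \<in> mcarrier A) \<Longrightarrow> sum f I \<in> mcarrier A"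
  using Modules.module.subspace_sum[of "mscale A" "mcarrier A" I f] kmod_module kmod_subspace by blast

lemma kmod_scale_add: "is_kmod H A \<Longrightarrow> mscale A c (x + y) = mscale A c x + mscale A c y"
  and kmod_scale_diff: "is_kmod H A \<Longrightarrow> mscale A c (x - y) = mscale A c x - mscale A c y"
  and kmod_scale_zero: "is_kmod H A \<Longrightarrow> mscale A c 0 = 0"
  and kmod_scale_left_minus: "is_kmod H A \<Longrightarrow> mscale A (- c) x = - mscale A c x"
  and kmod_scale_left_add: "is_kmod H A \<Longrightarrow> mscale A (c + d) x = mscale A c x + mscale A d x"
  and kmod_zero_scale: "is_kmod H A \<Longrightarrow> mscale A 0 x = 0"
  and kmod_scale_one: "is_kmod H A \<Longrightarrow> mscale A 1 x = x"
  and kmod_scale_scale: "is_kmod H A \<Longrightarrow> mscale A c (mscale A d x) = mscale A (c * d) x"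
  and kmod_scale_sum: "is_kmod H A \<Longrightarrow> mscale A c (sum f I) = (\<Sum>i\<in>I. mscale A c (f i))"
  by (erule kmod_module[THEN Modules.module.scale_right_distrib]
      | erule kmod_module[THEN Modules.module.scale_right_diff_distrib]
      | erule kmod_module[THEN Modules.module.scale_zero_right]
      | erule kmod_module[THEN Modules.module.scale_minus_left]
      | erule kmod_module[THEN Modules.module.scale_left_distrib]
      | erule kmod_module[THEN Modules.module.scale_zero_left]
      | erule kmod_module[THEN Modules.module.scale_one]
      | erule kmod_module[THEN Modules.module.scale_scale]
      | erule kmod_module[THEN Modules.module.scale_sum_right])+

lemma kmod_uminus: "is_kmod H A \<Longrightarrow> x \<in> mcarrier A \<Longrightarrow> - x \<in> mcarrier A"
  using kmod_diff[of H A 0 x] kmod_zero[of H A] by simp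

lemma kmod_act_zero:
  assumes "is_kmod H A" "h \<in> carrier H" shows "maction A h 0 = 0"
  using kmod_act_add[OF assms, of 0 0] kmod_zero[OF assms(1)] by simp

lemma kmod_act_diff:
  assumes "is_kmod H A" "h \<in> carrier H" "x \<in> mcarrier A" "y \<in> mcarrier A"
  shows "maction A h (x - y) = maction A h x - maction A h y"
  using kmod_act_add[OF assms(1,2), of "x - y" y] kmod_diff[OF assms(1)] assms by (simp add: algebra_simps)

lemma kmod_act_sum:
  assumes "is_kmod H A" "h \<in> carrier H" "\<And>i. i \<in> I \<Longrightarrow> f i \<in> mcarrier A"
  shows "maction A h (sum f I) = (\<Sum>i\<in>I. maction A h (f i))"
  using assms(3)
proof (induction I rule: infinite_finite_induct)
  case (insert i I)
  then show ?case
    using kmod_act_add[OF assms(1,2), of "f i" "sum f I"] kmod_sum[OF assms(1), of I f] by auto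
qed (auto simp: kmod_act_zero[OF assms(1,2)])

lemma is_kmod_subgrp:
  assumes "is_kmod G A" "subgroup H G" shows "is_kmod (subgrp G H) A"
  using assms subgroup.subset[OF assms(2)] unfolding is_kmod_def by (simp add: subset_iff)

lemma khomI:
  assumes "\<And>x. x \<in> mcarrier A \<Longrightarrow> f x \<in> mcarrier B"
    "\<And>x y. x \<in> mcarrier A \<Longrightarrow> y \<in> mcarrier A \<Longrightarrow> f (x + y) = f x + f y"
    "\<And>c x. x \<in> mcarrier A \<Longrightarrow> f (mscale A c x) = mscale B c (f x)"
    "\<And>h x. h \<in> carrier H \<Longrightarrow> x \<in> mcarrier A \<Longrightarrow> f (maction A h x) = maction B h (f x)"
    "\<And>x. x \<notin> mcarrier A \<Longrightarrow> f x = 0"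
  shows "f \<in> khom H A B"
  using assms by (simp add: khom_def)

lemma khom_mem: "f \<in> khom H A B \<Longrightarrow> x \<in> mcarrier A \<Longrightarrow> f x \<in> mcarrier B"
  and khom_add: "f \<in> khom H A B \<Longrightarrow> x \<in> mcarrier A \<Longrightarrow> y \<in> mcarrier A \<Longrightarrow> f (x + y) = f x + f y"
  and khom_scale: "f \<in> khom H A B \<Longrightarrow> x \<in> mcarrier A \<Longrightarrow> f (mscale A c x) = mscale B c (f x)"
  and khom_act: "f \<in> khom H A B \<Longrightarrow> h \<in> carrier H \<Longrightarrow> x \<in> mcarrier A \<Longrightarrow>
    f (maction A h x) = maction B h (f x)"
  and khom_out: "f \<in> khom H A B \<Longrightarrow> x \<notin> mcarrier A \<Longrightarrow> f x = 0"
  by (simp_all add: khom_def)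

text \<open>Additivity gives this when 0 lies in the carrier, and the normalisation outside the
  carrier gives it otherwise.\<close>

lemma khom_zero: "f \<in> khom H A B \<Longrightarrow> f 0 = 0"
  using khom_add[of f H A B 0 0] khom_out[of f H A B 0] by (cases "0 \<in> mcarrier A") auto

lemma khom_mem': "f \<in> khom H A B \<Longrightarrow> is_kmod H' B \<Longrightarrow> f x \<in> mcarrier B"
  using khom_mem[of f H A B x] khom_out[of f H A B x] kmod_zero[of H' B] by (cases "x \<in> mcarrier A") auto

lemma khom_diff:
  assumes "f \<in> khom H A B" "is_kmod H' A" "x \<in> mcarrier A" "y \<in> mcarrier A"
  shows "f (x - y) = f x - f y"
  using khom_add[OF assms(1), of "x - y" y] kmod_diff[OF assms(2-4)] assms(4) by simp

lemma khom_sum: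
  assumes "f \<in> khom H A B" "is_kmod H' A" "\<And>i. i \<in> I \<Longrightarrow> g i \<in> mcarrier A"
  shows "f (sum g I) = (\<Sum>i\<in>I. f (g i))"
  using assms(3)
proof (induction I rule: infinite_finite_induct)
  case (insert i I)
  then show ?case
    using khom_add[OF assms(1), of "g i" "sum g I"] kmod_sum[OF assms(2), of I g] by auto
qed (auto simp: khom_zero[OF assms(1)])

lemma khom_subgrp:
  assumes "f \<in> khom G A B" "subgroup H G" shows "f \<in> khom (subgrp G H) A B"
  using assms subgroup.subset[OF assms(2)] by (auto simp: khom_def)

lemma khom_comp:
  assumes "f \<in> khom H A B" "g \<in> khom H B C"
  shows "(\<lambda>x. g (f x)) \<in> khom H A C"
  using assms khom_zero[OF assms(2)] by (intro khomI) (auto simp: khom_def)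

lemma khom_plus:
  assumes "f \<in> khom H A B" "g \<in> khom H A B" "is_kmod H B"
  shows "(\<lambda>x. f x + g x) \<in> khom H A B"
  using assms(1,2) kmod_add[OF assms(3)] kmod_act_add[OF assms(3)] kmod_scale_add[OF assms(3)]
  by (intro khomI) (auto simp: khom_def)

lemma khom_minus:
  assumes "f \<in> khom H A B" "g \<in> khom H A B" "is_kmod H B"
  shows "(\<lambda>x. f x - g x) \<in> khom H A B"
  using assms(1,2) kmod_diff[OF assms(3)] kmod_act_diff[OF assms(3)] kmod_scale_diff[OF assms(3)]
  by (intro khomI) (auto simp: khom_def algebra_simps)

lemma khom_mscale:
  assumes "f \<in> khom H A B" "is_kmod H B"
  shows "(\<lambda>x. mscale B c (f x)) \<in> khom H A B"
  using assms(1) kmod_scale[OF assms(2)] kmod_act_scale[OF assms(2)] kmod_scale_add[OF assms(2)]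
    kmod_scale_scale[OF assms(2)] kmod_scale_zero[OF assms(2)]
  by (intro khomI) (auto simp: khom_def mult.commute)

lemma khom_null: "is_kmod H B \<Longrightarrow> (\<lambda>x. 0) \<in> khom H A B"
  by (intro khomI) (auto simp: kmod_zero kmod_scale_zero kmod_act_zero)

lemma khom_setsum:
  assumes "\<And>i. i \<in> I \<Longrightarrow> f i \<in> khom H A B" "is_kmod H B"
  shows "(\<lambda>x. \<Sum>i\<in>I. f i x) \<in> khom H A B"
  using assms(1)
  by (induction I rule: infinite_finite_induct)
    (auto intro: khom_plus[OF _ _ assms(2)] khom_null[OF assms(2)])

lemma khom_id: "is_kmod H A \<Longrightarrow> (\<lambda>x. if x \<in> mcarrier A then x else 0) \<in> khom H A A"
  by (intro khomI) (auto simp: kmod_add kmod_scale kmod_act)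

section \<open>Free and projective modules\<close>

definition free_basis :: "'z \<Rightarrow> 'z \<Rightarrow> 'k::field"
  where "free_basis z = (\<lambda>w. if w = z then 1 else 0)"

lemma free_kmod_is_kmod:
  fixes G :: "('g, 'b) monoid_scheme" (structure)
  assumes "group G" shows "is_kmod G (free_kmod G I :: ('k::field, 'g, 'i \<times> 'g \<Rightarrow> 'k) kmod)"
proof -
  interpret group G by fact
  let ?F = "free_kmod G I :: ('k, 'g, 'i \<times> 'g \<Rightarrow> 'k) kmod"
  have vs: "vector_space (mscale ?F)"
    by unfold_locales (auto simp: free_kmod_def fun_eq_iff algebra_simps)
  interpret vector_space "mscale ?F" by (rule vs)
  have sub: "subspace (mcarrier ?F)"
  proof (rule subspaceI)
    fix x y :: "'i \<times> 'g \<Rightarrow> 'k" assume "x \<in> mcarrier ?F" "y \<in> mcarrier ?F"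
    moreover have "{z. (x + y) z \<noteq> 0} \<subseteq> {z. x z \<noteq> 0} \<union> {z. y z \<noteq> 0}" by auto
    ultimately show "x + y \<in> mcarrier ?F"
      unfolding free_kmod_def by (auto intro: finite_subset dest: subsetD)
  next
    fix c and x :: "'i \<times> 'g \<Rightarrow> 'k" assume x: "x \<in> mcarrier ?F"
    have "{z. c * x z \<noteq> 0} \<subseteq> {z. x z \<noteq> 0}" by auto
    then show "mscale ?F c x \<in> mcarrier ?F"
      using x unfolding free_kmod_def by (auto intro: finite_subset dest: subsetD)
  qed (simp add: free_kmod_def)
  have act: "maction ?F h x \<in> mcarrier ?F" if h: "h \<in> carrier G" and x: "x \<in> mcarrier ?F" for h x
  proof -
    \<comment> \<open>Acting by h moves the support by h, so it stays finite and inside the allowed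
      index set.\<close>
    have sub: "{z. maction ?F h x z \<noteq> 0} \<subseteq> (\<lambda>(i, g). (i, h \<otimes> g)) ` {z. x z \<noteq> 0}"
    proof
      fix z assume z: "z \<in> {z. maction ?F h x z \<noteq> 0}"
      obtain i g where ig: "z = (i, g)" by (cases z)
      have g: "g \<in> carrier G" and nz: "x (i, inv h \<otimes> g) \<noteq> 0"
        using z by (auto simp: ig free_kmod_def split: if_splits)
      have "z = (\<lambda>(i, g). (i, h \<otimes> g)) (i, inv h \<otimes> g)"
        using g h by (simp add: ig m_assoc[symmetric])
      with nz show "z \<in> (\<lambda>(i, g). (i, h \<otimes> g)) ` {z. x z \<noteq> 0}" by blast
    qed
    have fin: "finite {z. x z \<noteq> 0}" and supp: "{z. x z \<noteq> 0} \<subseteq> I \<times> carrier G"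
      using x by (simp_all add: free_kmod_def)
    have "(\<lambda>(i, g). (i, h \<otimes> g)) ` (I \<times> carrier G) \<subseteq> I \<times> carrier G"
      using h by auto
    then have "{z. maction ?F h x z \<noteq> 0} \<subseteq> I \<times> carrier G"
      by (rule subset_trans[OF subset_trans[OF sub image_mono[OF supp]]])
    with finite_subset[OF sub finite_imageI[OF fin]] show ?thesis by (simp add: free_kmod_def)
  qed
  show ?thesis
    unfolding is_kmod_def
  proof (intro conjI ballI allI vs sub act)
    fix x assume x: "x \<in> mcarrier ?F"
    \<comment> \<open>The action returns 0 off the carrier of the group, so the unit fixes x only
      because x vanishes there too.\<close>
    have "x (i, h) = 0" if "h \<notin> carrier G" for i h
      using x that by (auto simp: free_kmod_def)
    then show "maction ?F \<one>\<^bsub>G\<^esub> x = x"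
      by (auto simp: free_kmod_def fun_eq_iff)
  qed (auto simp: free_kmod_def fun_eq_iff inv_mult_group m_assoc)
qed

lemma free_basis_mem:
  "i \<in> I \<Longrightarrow> g \<in> carrier G \<Longrightarrow>
    free_basis (i, g) \<in> mcarrier (free_kmod G I :: ('k::field, 'g, 'i \<times> 'g \<Rightarrow> 'k) kmod)"
  by (auto simp: free_basis_def free_kmod_def)

lemma free_basis_act:
  fixes G :: "('g, 'b) monoid_scheme" (structure)
  assumes "group G" "h \<in> carrier G" "g \<in> carrier G"
  shows "maction (free_kmod G I) h (free_basis (i, g)) = free_basis (i, h \<otimes>\<^bsub>G\<^esub> g)"
proof -
  interpret group G by fact
  have "inv h \<otimes> k = g \<longleftrightarrow> k = h \<otimes> g" if "k \<in> carrier G" for k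
    using that assms inv_solve_left' by (metis inv_closed inv_inv inv_solve_left)
  then show ?thesis using assms
    by (auto simp: free_basis_def free_kmod_def fun_eq_iff)
qed

lemma sum_fun_apply: "sum f S x = (\<Sum>i\<in>S. f i x)"
  for f :: "'i \<Rightarrow> 'x \<Rightarrow> 'y::comm_monoid_add"
  by (induction S rule: infinite_finite_induct) auto

lemma free_expand:
  assumes "group G" "\<phi> \<in> mcarrier (free_kmod G I :: ('k::field, 'g, 'i \<times> 'g \<Rightarrow> 'k) kmod)"
  shows "\<phi> = (\<Sum>z\<in>{z. \<phi> z \<noteq> 0}. mscale (free_kmod G I) (\<phi> z) (free_basis z))"
proof
  fix w
  have fin: "finite {z. \<phi> z \<noteq> 0}" using assms(2) by (auto simp: free_kmod_def)
  show "\<phi> w = (\<Sum>z\<in>{z. \<phi> z \<noteq> 0}. mscale (free_kmod G I) (\<phi> z) (free_basis z)) w"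
    unfolding sum_fun_apply using fin by (auto simp: free_kmod_def free_basis_def if_distrib sum.delta cong: if_cong)
qed

text \<open>The elements \<open>free_basis z\<close> span over K, so identities between
  homomorphisms need to be checked only on them.\<close>

lemma khom_free_expand:
  assumes "group G" "f \<in> khom H (free_kmod G I) B"
    "\<phi> \<in> mcarrier (free_kmod G I :: ('k::field, 'g, 'i \<times> 'g \<Rightarrow> 'k) kmod)"
  shows "f \<phi> = (\<Sum>z\<in>{z. \<phi> z \<noteq> 0}. mscale B (\<phi> z) (f (free_basis z)))"
proof -
  note F = free_kmod_is_kmod[OF assms(1), of I, where ?'k = 'k]
  have mem: "free_basis z \<in> mcarrier (free_kmod G I :: ('k, 'g, 'i \<times> 'g \<Rightarrow> 'k) kmod)" if "z \<in> {z. \<phi> z \<noteq> 0}" for z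
    using assms(3) that free_basis_mem[of "fst z" I "snd z" G, where ?'k = 'k]
    by (cases z) (auto simp: free_kmod_def)
  have "f \<phi> = f (\<Sum>z\<in>{z. \<phi> z \<noteq> 0}. mscale (free_kmod G I) (\<phi> z) (free_basis z))"
    using free_expand[OF assms(1,3)] by simp
  also have "\<dots> = (\<Sum>z\<in>{z. \<phi> z \<noteq> 0}. f (mscale (free_kmod G I) (\<phi> z) (free_basis z)))"
    by (rule khom_sum[OF assms(2) F]) (use kmod_scale[OF F] mem in blast)
  also have "\<dots> = (\<Sum>z\<in>{z. \<phi> z \<noteq> 0}. mscale B (\<phi> z) (f (free_basis z)))"
    by (rule sum.cong) (use khom_scale[OF assms(2)] mem in auto)
  finally show ?thesis .
qed

text \<open>The subgroup H is there because a free module over G has to be restricted to H.\<close>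

lemma free_kmod_extend:
  fixes G :: "('g, 'b) monoid_scheme" (structure) and a :: "'i \<times> 'g \<Rightarrow> 'y::ab_group_add"
  assumes G: "group G" and H: "subgroup H G" and B: "is_kmod (subgrp G H) B"
    and mem: "\<And>i g. i \<in> I \<Longrightarrow> g \<in> carrier G \<Longrightarrow> a (i, g) \<in> mcarrier B"
    and act: "\<And>i h g. i \<in> I \<Longrightarrow> h \<in> H \<Longrightarrow> g \<in> carrier G \<Longrightarrow> a (i, h \<otimes>\<^bsub>G\<^esub> g) = maction B h (a (i, g))"
  obtains f where "f \<in> khom (subgrp G H) (free_kmod G I :: ('k::field, 'g, 'i \<times> 'g \<Rightarrow> 'k) kmod) B"
    "\<And>i g. i \<in> I \<Longrightarrow> g \<in> carrier G \<Longrightarrow> f (free_basis (i, g)) = a (i, g)"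
proof -
  interpret group G by fact
  let ?F = "free_kmod G I :: ('k, 'g, 'i \<times> 'g \<Rightarrow> 'k) kmod"
  note F = free_kmod_is_kmod[OF G, of I, where ?'k = 'k]
  define f where "f \<phi> = (if \<phi> \<in> mcarrier ?F then \<Sum>z\<in>{z. \<phi> z \<noteq> 0}. mscale B (\<phi> z) (a z) else 0)" for \<phi>
  \<comment> \<open>Summation over any finite set containing the support lets \<phi>, \<psi> and
    their sum share one index set.\<close>
  have f_eq: "f \<phi> = (\<Sum>z\<in>S. mscale B (\<phi> z) (a z))"
    if "finite S" "{z. \<phi> z \<noteq> 0} \<subseteq> S" "\<phi> \<in> mcarrier ?F" for S \<phi>
    unfolding f_def using that by (auto intro!: sum.mono_neutral_left simp: kmod_zero_scale[OF B])
  have fin: "finite {z. \<phi> z \<noteq> 0}" and supp: "{z. \<phi> z \<noteq> 0} \<subseteq> I \<times> carrier G" if "\<phi> \<in> mcarrier ?F" for \<phi>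
    using that by (auto simp: free_kmod_def)
  have "f \<in> khom (subgrp G H) ?F B"
  proof (rule khomI)
    fix \<phi> assume \<phi>: "\<phi> \<in> mcarrier ?F"
    then show "f \<phi> \<in> mcarrier B"
      unfolding f_def using supp[OF \<phi>] mem by (auto intro!: kmod_sum[OF B] kmod_scale[OF B])
  next
    fix \<phi> \<psi> assume \<phi>: "\<phi> \<in> mcarrier ?F" and \<psi>: "\<psi> \<in> mcarrier ?F"
    let ?S = "{z. \<phi> z \<noteq> 0} \<union> {z. \<psi> z \<noteq> 0}"
    have S: "finite ?S" using fin \<phi> \<psi> by simp
    have "f (\<phi> + \<psi>) = (\<Sum>z\<in>?S. mscale B ((\<phi> + \<psi>) z) (a z))"
      by (rule f_eq[OF S]) (use kmod_add[OF F \<phi> \<psi>] in auto)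
    also have "\<dots> = f \<phi> + f \<psi>"
      using f_eq[OF S, of \<phi>] f_eq[OF S, of \<psi>] \<phi> \<psi>
      by (simp add: kmod_scale_left_add[OF B] sum.distrib)
    finally show "f (\<phi> + \<psi>) = f \<phi> + f \<psi>" .
  next
    fix c \<phi> assume \<phi>: "\<phi> \<in> mcarrier ?F"
    have "f (mscale ?F c \<phi>) = (\<Sum>z\<in>{z. \<phi> z \<noteq> 0}. mscale B (mscale ?F c \<phi> z) (a z))"
      by (rule f_eq[OF fin[OF \<phi>]]) (use kmod_scale[OF F \<phi>] in \<open>auto simp: free_kmod_def\<close>)
    then show "f (mscale ?F c \<phi>) = mscale B c (f \<phi>)"
      using \<phi> by (simp add: f_def kmod_scale_sum[OF B] kmod_scale_scale[OF B] free_kmod_def)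
  next
    fix h \<phi> assume "h \<in> carrier (subgrp G H)" and \<phi>: "\<phi> \<in> mcarrier ?F"
    then have hH: "h \<in> H" and h: "h \<in> carrier G" using subgroup.subset[OF H] by auto
    have h\<phi>: "maction ?F h \<phi> \<in> mcarrier ?F" using kmod_act[OF F h \<phi>] .
    let ?t = "\<lambda>(i, g). (i, h \<otimes> g)"
    have inj: "inj_on ?t {z. \<phi> z \<noteq> 0}"
      using h by (intro inj_on_subset[OF _ supp[OF \<phi>]]) (auto simp: inj_on_def)
    have sub: "{z. maction ?F h \<phi> z \<noteq> 0} \<subseteq> ?t ` {z. \<phi> z \<noteq> 0}"
    proof
      fix z assume z: "z \<in> {z. maction ?F h \<phi> z \<noteq> 0}"
      obtain i g where ig: "z = (i, g)" by (cases z)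
      have g: "g \<in> carrier G" and nz: "\<phi> (i, inv h \<otimes> g) \<noteq> 0"
        using z by (auto simp: ig free_kmod_def split: if_splits)
      have "z = ?t (i, inv h \<otimes> g)"
        using g h by (simp add: ig m_assoc[symmetric])
      with nz show "z \<in> ?t ` {z. \<phi> z \<noteq> 0}" by blast
    qed
    have "f (maction ?F h \<phi>) = (\<Sum>z\<in>?t ` {z. \<phi> z \<noteq> 0}. mscale B (maction ?F h \<phi> z) (a z))"
      by (rule f_eq[OF _ sub h\<phi>]) (use fin[OF \<phi>] in simp)
    also have "\<dots> = (\<Sum>z\<in>{z. \<phi> z \<noteq> 0}. mscale B (maction ?F h \<phi> (?t z)) (a (?t z)))"
      by (subst sum.reindex[OF inj]) simp
    also have "\<dots> = (\<Sum>z\<in>{z. \<phi> z \<noteq> 0}. maction B h (mscale B (\<phi> z) (a z)))"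
    proof (rule sum.cong)
      fix z assume z: "z \<in> {z. \<phi> z \<noteq> 0}"
      obtain i g where ig: "z = (i, g)" by (cases z)
      have ig': "i \<in> I" "g \<in> carrier G" using z supp[OF \<phi>] by (auto simp: ig)
      have "maction ?F h \<phi> (?t z) = \<phi> z"
        using h ig' by (simp add: ig free_kmod_def m_assoc[symmetric])
      then show "mscale B (maction ?F h \<phi> (?t z)) (a (?t z)) = maction B h (mscale B (\<phi> z) (a z))"
        using act[OF ig'(1) hH ig'(2)] kmod_act_scale[OF B, of h "a z"] mem[OF ig'] hH by (simp add: ig)
    qed simp
    also have "\<dots> = maction B h (f \<phi>)"
    proof -
      have "mscale B (\<phi> z) (a z) \<in> mcarrier B" if "z \<in> {z. \<phi> z \<noteq> 0}" for z
        using that supp[OF \<phi>] mem by (cases z) (auto intro!: kmod_scale[OF B])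
      then show ?thesis
        using kmod_act_sum[OF B, of h "{z. \<phi> z \<noteq> 0}" "\<lambda>z. mscale B (\<phi> z) (a z)"] hH \<phi>
        by (simp add: f_def)
    qed
    finally show "f (maction ?F h \<phi>) = maction B h (f \<phi>)" .
  qed (simp add: f_def)
  moreover have "f (free_basis (i, g)) = a (i, g)" if "i \<in> I" "g \<in> carrier G" for i g
  proof -
    have "{z. (free_basis (i, g) :: 'i \<times> 'g \<Rightarrow> 'k) z \<noteq> 0} = {(i, g)}"
      by (auto simp: free_basis_def)
    then show ?thesis
      using free_basis_mem[OF that, where ?'k = 'k] by (simp add: f_def free_basis_def kmod_scale_one[OF B])
  qed
  ultimately show thesis using that by blast
qed

text \<open>A free G-module stays projective over H. Preimages chosen independently at all basis
  elements need not be compatible with H, so they are chosen at coset representatives only and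
  spread by the action of H.\<close>

lemma free_kmod_lift:
  fixes G :: "('g, 'b) monoid_scheme" (structure)
  assumes G: "group G" and H: "subgroup H G" and B: "is_kmod (subgrp G H) B"
    and g: "g \<in> khom (subgrp G H) (free_kmod G I :: ('k::field, 'g, 'i \<times> 'g \<Rightarrow> 'k) kmod) C"
    and \<pi>: "\<pi> \<in> khom (subgrp G H) B C"
    and im: "g ` mcarrier (free_kmod G I :: ('k, 'g, 'i \<times> 'g \<Rightarrow> 'k) kmod) \<subseteq> \<pi> ` mcarrier B"
  obtains f where "f \<in> khom (subgrp G H) (free_kmod G I :: ('k, 'g, 'i \<times> 'g \<Rightarrow> 'k) kmod) B"
    "\<And>x. x \<in> mcarrier (free_kmod G I :: ('k, 'g, 'i \<times> 'g \<Rightarrow> 'k) kmod) \<Longrightarrow> \<pi> (f x) = g x"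
proof -
  interpret group G by fact
  let ?F = "free_kmod G I :: ('k, 'g, 'i \<times> 'g \<Rightarrow> 'k) kmod"
  note F = free_kmod_is_kmod[OF G, of I, where ?'k = 'k]
  \<comment> \<open>Over H the module is free on the basis elements at the coset representatives \<rho> u.\<close>
  define \<rho> where "\<rho> u = (SOME w. w \<in> H #> u)" for u
  have \<rho>: "\<rho> u \<in> H #> u" if "u \<in> carrier G" for u
    unfolding \<rho>_def using rcos_self[OF that H] by (rule someI)
  have \<rho>c: "\<rho> u \<in> carrier G" if "u \<in> carrier G" for u
    using \<rho>[OF that] that subgroup.subset[OF H] by (auto simp: r_coset_def)
  have \<rho>h: "\<rho> (h \<otimes> u) = \<rho> u" if "h \<in> H" "u \<in> carrier G" for h u
  proof -
    have "H #> (h \<otimes> u) = H #> u"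
      using that H subgroup.subset[OF H] coset_mult_assoc[of H h u] coset_join2[of h H] by auto
    then show ?thesis by (simp add: \<rho>_def)
  qed
  \<comment> \<open>The H-part of u in the factorisation u = t u \<otimes> \<rho> u.\<close>
  define t where "t u = u \<otimes> inv (\<rho> u)" for u
  have t: "t u \<in> H" "t u \<otimes> \<rho> u = u" if u: "u \<in> carrier G" for u
  proof -
    obtain h where h: "h \<in> H" "\<rho> u = h \<otimes> u" using \<rho>[OF u] by (auto simp: r_coset_def)
    have hc: "h \<in> carrier G" using h subgroup.subset[OF H] by auto
    have "t u = inv h" using u hc unfolding t_def h(2) by (simp add: inv_mult_group m_assoc[symmetric])
    then show "t u \<in> H" using subgroup.m_inv_closed[OF H h(1)] by simp
    show "t u \<otimes> \<rho> u = u" using u \<rho>c[OF u] by (simp add: t_def m_assoc)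
  qed
  have th: "t (h \<otimes> u) = h \<otimes> t u" if "h \<in> H" "u \<in> carrier G" for h u
    using that subgroup.subset[OF H] \<rho>c[of u] by (auto simp: t_def \<rho>h m_assoc)
  define b where "b z = (SOME y. y \<in> mcarrier B \<and> \<pi> y = g (free_basis z))" for z
  have b: "b (i, u) \<in> mcarrier B \<and> \<pi> (b (i, u)) = g (free_basis (i, u))" if "i \<in> I" "u \<in> carrier G" for i u
    unfolding b_def by (rule someI_ex) (use im free_basis_mem[OF that, where ?'k = 'k] in force)
  define a where "a = (\<lambda>(i, u). maction B (t u) (b (i, \<rho> u)))"
  have amem: "a (i, u) \<in> mcarrier B" if "i \<in> I" "u \<in> carrier G" for i u
    using kmod_act[OF B, of "t u"] t[OF that(2)] b[OF that(1) \<rho>c[OF that(2)]] by (simp add: a_def)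
  have aact: "a (i, h \<otimes> u) = maction B h (a (i, u))" if "i \<in> I" "h \<in> H" "u \<in> carrier G" for i h u
    using kmod_act_mult[OF B, of h "t u"] t[OF that(3)] b[OF that(1) \<rho>c[OF that(3)]] that
    by (simp add: a_def \<rho>h th)
  obtain f where f: "f \<in> khom (subgrp G H) ?F B"
    and fb: "\<And>i u. i \<in> I \<Longrightarrow> u \<in> carrier G \<Longrightarrow> f (free_basis (i, u)) = a (i, u)"
    using free_kmod_extend[of G H B I a] G H B amem aact by blast
  have \<pi>f: "(\<lambda>x. \<pi> (f x)) \<in> khom (subgrp G H) ?F C" using khom_comp[OF f \<pi>] .
  have eq: "\<pi> (f (free_basis (i, u))) = g (free_basis (i, u))" if iu: "i \<in> I" "u \<in> carrier G" for i u
  proof -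
    note \<rho>u = \<rho>c[OF iu(2)]
    have "\<pi> (f (free_basis (i, u))) = maction C (t u) (g (free_basis (i, \<rho> u)))"
      using khom_act[OF \<pi>, of "t u" "b (i, \<rho> u)"] t[OF iu(2)] b[OF iu(1) \<rho>u]
      by (simp add: fb[OF iu] a_def)
    also have "\<dots> = g (maction ?F (t u) (free_basis (i, \<rho> u)))"
      using khom_act[OF g, of "t u"] t[OF iu(2)] free_basis_mem[OF iu(1) \<rho>u, where ?'k = 'k] by simp
    also have "\<dots> = g (free_basis (i, u))"
      using t[OF iu(2)] \<rho>u subgroup.subset[OF H] by (subst free_basis_act[OF G]) auto
    finally show ?thesis .
  qed
  have "\<pi> (f x) = g x" if x: "x \<in> mcarrier ?F" for x
  proof -
    have "x z \<noteq> 0 \<Longrightarrow> \<pi> (f (free_basis z)) = g (free_basis z)" for z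
      using eq[of "fst z" "snd z"] x by (auto simp: free_kmod_def)
    then show ?thesis
      unfolding khom_free_expand[OF G \<pi>f x] khom_free_expand[OF G g x] by (intro sum.cong) auto
  qed
  with f show thesis using that by blast
qed

text \<open>A lift over the surrounding free module, restricted to the summand. The subgroup allows
  terms of a G-resolution to be lifted along M-homomorphisms.\<close>

lemma projective_lift:
  fixes A :: "('k::field, 'g, 'x::ab_group_add) kmod"
  assumes G: "group G" and H: "subgroup H G" and A: "projective_kmod G A"
    and B: "is_kmod (subgrp G H) B"
    and g: "g \<in> khom (subgrp G H) A C" and \<pi>: "\<pi> \<in> khom (subgrp G H) B C"
    and im: "g ` mcarrier A \<subseteq> \<pi> ` mcarrier B"
  obtains f where "f \<in> khom (subgrp G H) A B" "\<And>x. x \<in> mcarrier A \<Longrightarrow> \<pi> (f x) = g x"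
proof -
  obtain I :: "'x set" and \<iota> p where \<iota>: "\<iota> \<in> khom G A (free_kmod G I)" and p: "p \<in> khom G (free_kmod G I) A"
    and p\<iota>: "\<And>x. x \<in> mcarrier A \<Longrightarrow> p (\<iota> x) = x"
    using A unfolding projective_kmod_def by blast
  have "(\<lambda>x. g (p x)) \<in> khom (subgrp G H) (free_kmod G I) C"
    by (rule khom_comp[OF khom_subgrp[OF p H] g])
  moreover have "(\<lambda>x. g (p x)) ` mcarrier (free_kmod G I) \<subseteq> \<pi> ` mcarrier B"
    using im khom_mem[OF p] by blast
  ultimately obtain f where f: "f \<in> khom (subgrp G H) (free_kmod G I) B"
    "\<And>x. x \<in> mcarrier (free_kmod G I) \<Longrightarrow> \<pi> (f x) = g (p x)"
    using free_kmod_lift[OF G H B _ \<pi>] by blast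
  show thesis
    by (rule that[OF khom_comp[OF khom_subgrp[OF \<iota> H] f(1)]]) (simp add: f(2) p\<iota> khom_mem[OF \<iota>])
qed

text \<open>If u x were nonzero, a functional l with l (u x) = 1 would make the kernel of l u a
  proper submodule that together with N spans A, against superfluity.\<close>

lemma superfluous_hom_trivial:
  fixes V :: "('k::field, 'g, 'v::ab_group_add) kmod"
  assumes N: "superfluous H A N" and A: "is_kmod H A" and V: "is_kmod H V"
    and triv: "\<And>h v. h \<in> carrier H \<Longrightarrow> v \<in> mcarrier V \<Longrightarrow> maction V h v = v"
    and u: "u \<in> khom H A V" and x: "x \<in> N"
  shows "u x = 0"
proof (rule ccontr)
  assume nz: "u x \<noteq> 0"
  interpret V: vector_space "mscale V" by (rule kmod_vs[OF V])
  interpret A: vector_space "mscale A" by (rule kmod_vs[OF A])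
  interpret K: vector_space "(*) :: 'k \<Rightarrow> 'k \<Rightarrow> 'k" by unfold_locales (auto simp: algebra_simps)
  interpret VK: vector_space_pair "mscale V" "(*) :: 'k \<Rightarrow> 'k \<Rightarrow> 'k" ..
  obtain l where l: "Vector_Spaces.linear (mscale V) (*) l" "l (u x) = (1::'k)"
    using VK.linear_independent_extend[of "{u x}" "\<lambda>_. 1"] nz by auto
  interpret l: Vector_Spaces.linear "mscale V" "(*)" l by (rule l(1))
  have NA: "N \<subseteq> mcarrier A" and Nsub: "A.subspace N" using N by (auto simp: superfluous_def submod_def)
  \<comment> \<open>The functional l is only K-linear, yet U is stable under the group because the
    action on V is trivial.\<close>
  define U where "U = {y \<in> mcarrier A. l (u y) = 0}"
  have "submod H A U"
    unfolding submod_def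
  proof (intro conjI ballI)
    show "A.subspace U"
      by (rule A.subspaceI) (auto simp: U_def kmod_zero[OF A] kmod_add[OF A] kmod_scale[OF A]
          khom_zero[OF u] khom_add[OF u] khom_scale[OF u] l.add l.scale)
    fix h y assume "h \<in> carrier H" "y \<in> U"
    then show "maction A h y \<in> U"
      by (auto simp: U_def kmod_act[OF A] khom_act[OF u] triv khom_mem[OF u])
  qed (auto simp: U_def)
  moreover have "N + U = mcarrier A"
  proof
    show "N + U \<subseteq> mcarrier A"
      using NA kmod_add[OF A] by (auto simp: set_plus_def U_def)
    show "mcarrier A \<subseteq> N + U"
    proof
      fix y assume y: "y \<in> mcarrier A"
      \<comment> \<open>The multiple of x with the same value as y under l u, so that y - z falls
        into U.\<close>
      define z where "z = mscale A (l (u y)) x"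
      have z: "z \<in> N" unfolding z_def by (rule A.subspace_scale[OF Nsub x])
      have "u (y - z) = u y - mscale V (l (u y)) (u x)"
        using y z NA x by (subst khom_diff[OF u A]) (auto simp: z_def khom_scale[OF u])
      then have "y - z \<in> U"
        using y z NA by (auto simp: U_def kmod_diff[OF A] l.diff l.scale l(2))
      then show "y \<in> N + U" using z set_plus_intro[of z N "y - z" U] by simp
    qed
  qed
  ultimately have "U = mcarrier A" using N by (auto simp: superfluous_def)
  then have "l (u x) = 0" using x NA by (auto simp: U_def)
  then show False using l(2) by simp
qed

section \<open>Resolutions\<close>

text \<open>In degree 0 the augmentation replaces the differential, which gives exactness one form
  in all degrees.\<close>

definition res_cycles ::
    "(nat \<Rightarrow> ('k::field, 'g, 'x::ab_group_add) kmod) \<Rightarrow> (nat \<Rightarrow> 'x \<Rightarrow> 'x) \<Rightarrow> ('x \<Rightarrow> 'k) \<Rightarrow> nat \<Rightarrow> 'x set"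
  where "res_cycles A d \<epsilon> k = {x \<in> mcarrier (A k). if k = 0 then \<epsilon> x = 0 else d k x = 0}"

lemma resolution_kmod: "projective_resolution H A d \<epsilon> \<Longrightarrow> is_kmod H (A k)"
  and resolution_projective: "projective_resolution H A d \<epsilon> \<Longrightarrow> projective_kmod H (A k)"
  and resolution_diff: "projective_resolution H A d \<epsilon> \<Longrightarrow> d (Suc k) \<in> khom H (A (Suc k)) (A k)"
  and resolution_diff_diff: "projective_resolution H A d \<epsilon> \<Longrightarrow> x \<in> mcarrier (A (Suc k)) \<Longrightarrow>
    d k (d (Suc k) x) = 0"
  and resolution_aug: "projective_resolution H A d \<epsilon> \<Longrightarrow> \<epsilon> \<in> khom H (A 0) trivial_kmod"
  and resolution_aug_surj: "projective_resolution H A d \<epsilon> \<Longrightarrow> \<epsilon> ` mcarrier (A 0) = UNIV"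
  by (simp_all add: projective_resolution_def chain_complex_def)

lemma resolution_exact:
  "projective_resolution H A d \<epsilon> \<Longrightarrow> d (Suc k) ` mcarrier (A (Suc k)) = res_cycles A d \<epsilon> k"
  by (cases k) (auto simp: projective_resolution_def res_cycles_def)

lemma resolution_diff_cycles:
  "projective_resolution H A d \<epsilon> \<Longrightarrow> x \<in> mcarrier (A (Suc k)) \<Longrightarrow> d (Suc k) x \<in> res_cycles A d \<epsilon> k"
  using resolution_exact by blast

text \<open>The terms of Y remain projective over H and P is exact, so the identity of K lifts
  degree by degree. The result goes from Y to P, opposite to \<theta>, and serves as its homotopy
  inverse on one side.\<close>

lemma comparison_map:
  fixes P :: "nat \<Rightarrow> ('k::field, 'g, 'x::ab_group_add) kmod"
    and Y :: "nat \<Rightarrow> ('k, 'g, 'y::ab_group_add) kmod"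
  assumes G: "group G" and H: "subgroup H G"
    and Y: "projective_resolution G Y dY \<epsilon>Y" and P: "projective_resolution (subgrp G H) P dP \<epsilon>P"
  obtains \<rho> where "chain_map (subgrp G H) Y dY P dP \<rho>"
    "\<And>y. y \<in> mcarrier (Y 0) \<Longrightarrow> \<epsilon>P (\<rho> 0 y) = \<epsilon>Y y"
proof -
  \<comment> \<open>Sending cycles to cycles is what lets the next lift exist: boundaries of Y then
    land in cycles of P, which are boundaries.\<close>
  define good where "good n f \<longleftrightarrow> f \<in> khom (subgrp G H) (Y n) (P n) \<and>
    f ` res_cycles Y dY \<epsilon>Y n \<subseteq> res_cycles P dP \<epsilon>P n \<and>
    (n = 0 \<longrightarrow> (\<forall>y\<in>mcarrier (Y 0). \<epsilon>P (f y) = \<epsilon>Y y))" for n f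
  have "\<exists>f. good 0 f"
  proof -
    have "\<epsilon>Y ` mcarrier (Y 0) \<subseteq> \<epsilon>P ` mcarrier (P 0)" using resolution_aug_surj[OF P] by simp
    then obtain f where "f \<in> khom (subgrp G H) (Y 0) (P 0)" "\<And>y. y \<in> mcarrier (Y 0) \<Longrightarrow> \<epsilon>P (f y) = \<epsilon>Y y"
      using projective_lift[OF G H resolution_projective[OF Y] resolution_kmod[OF P]
          khom_subgrp[OF resolution_aug[OF Y] H] resolution_aug[OF P]] by blast
    then show ?thesis
      by (intro exI[of _ f]) (auto simp: good_def res_cycles_def khom_mem)
  qed
  moreover have "\<exists>f'. good (Suc n) f' \<and> (\<forall>y\<in>mcarrier (Y (Suc n)). dP (Suc n) (f' y) = f (dY (Suc n) y))"
    if "good n f" for n f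
  proof -
    have f: "f \<in> khom (subgrp G H) (Y n) (P n)" and fc: "f ` res_cycles Y dY \<epsilon>Y n \<subseteq> res_cycles P dP \<epsilon>P n"
      using that by (auto simp: good_def)
    have "(\<lambda>y. f (dY (Suc n) y)) ` mcarrier (Y (Suc n)) \<subseteq> dP (Suc n) ` mcarrier (P (Suc n))"
      unfolding resolution_exact[OF P] using fc resolution_diff_cycles[OF Y] by blast
    then obtain f' where f': "f' \<in> khom (subgrp G H) (Y (Suc n)) (P (Suc n))"
      "\<And>y. y \<in> mcarrier (Y (Suc n)) \<Longrightarrow> dP (Suc n) (f' y) = f (dY (Suc n) y)"
      using projective_lift[OF G H resolution_projective[OF Y] resolution_kmod[OF P]
          khom_comp[OF khom_subgrp[OF resolution_diff[OF Y] H] f] resolution_diff[OF P]] by blast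
    then show ?thesis
      by (intro exI[of _ f']) (auto simp: good_def res_cycles_def khom_mem khom_zero[OF f])
  qed
  ultimately obtain \<rho> where \<rho>: "\<And>n. good n (\<rho> n)"
    "\<And>n. \<forall>y\<in>mcarrier (Y (Suc n)). dP (Suc n) (\<rho> (Suc n) y) = \<rho> n (dY (Suc n) y)"
    using dependent_nat_choice[of good "\<lambda>n f f'. \<forall>y\<in>mcarrier (Y (Suc n)). dP (Suc n) (f' y) = f (dY (Suc n) y)"]
    by metis
  show thesis
    by (rule that[of \<rho>]) (use \<rho> in \<open>auto simp: chain_map_def good_def\<close>)
qed

text \<open>The target is an abstract sequence with maps \<open>E\<close>, exact in positive
  positions, so that one proof serves three targets: P itself, Y with twisted action, and Y shifted
  by one degree with negated differential. In position 0 the condition \<open>base\<close> takes the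
  place of exactness.\<close>

lemma null_homotopy:
  fixes P :: "nat \<Rightarrow> ('k::field, 'g, 'x::ab_group_add) kmod"
    and B :: "nat \<Rightarrow> ('k, 'g, 'y::ab_group_add) kmod"
  assumes H: "group H"
    and P: "projective_resolution H P dP \<epsilon>P"
    and B: "\<And>k. is_kmod H (B k)" and E: "\<And>k. E k \<in> khom H (B (Suc k)) (B k)"
    and exact: "\<And>k y. y \<in> mcarrier (B (Suc k)) \<Longrightarrow> E k y = 0 \<Longrightarrow> y \<in> E (Suc k) ` mcarrier (B (Suc (Suc k)))"
    and g: "\<And>k. g k \<in> khom H (P k) (B k)"
    and base: "g 0 ` mcarrier (P 0) \<subseteq> E 0 ` mcarrier (B (Suc 0))"
    and chain: "\<And>k x. x \<in> mcarrier (P (Suc k)) \<Longrightarrow> E k (g (Suc k) x) = g k (dP (Suc k) x)"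
  obtains h where "\<And>k. h k \<in> khom H (P k) (B (Suc k))"
    "\<And>x. x \<in> mcarrier (P 0) \<Longrightarrow> E 0 (h 0 x) = g 0 x"
    "\<And>k x. x \<in> mcarrier (P (Suc k)) \<Longrightarrow> E (Suc k) (h (Suc k) x) + h k (dP (Suc k) x) = g (Suc k) x"
proof -
  note lift = projective_lift[OF H group.subgroup_self[OF H] resolution_projective[OF P], simplified]
  note d = resolution_diff[OF P]
  \<comment> \<open>The clause on boundaries makes the defect \<open>?c\<close> of the next degree a
    cycle, hence liftable.\<close>
  define good where "good n f \<longleftrightarrow> f \<in> khom H (P n) (B (Suc n)) \<and>
    (\<forall>x\<in>mcarrier (P (Suc n)). E n (f (dP (Suc n) x)) = g n (dP (Suc n) x)) \<and>
    (n = 0 \<longrightarrow> (\<forall>x\<in>mcarrier (P 0). E 0 (f x) = g 0 x))" for n f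
  have "\<exists>f. good 0 f"
  proof -
    obtain f where "f \<in> khom H (P 0) (B (Suc 0))" "\<And>x. x \<in> mcarrier (P 0) \<Longrightarrow> E 0 (f x) = g 0 x"
      using lift[OF B g E base] by blast
    then show ?thesis using khom_mem[OF d]
      by (intro exI[of _ f]) (auto simp: good_def)
  qed
  moreover have "\<exists>f'. good (Suc n) f' \<and>
      (\<forall>x\<in>mcarrier (P (Suc n)). E (Suc n) (f' x) + f (dP (Suc n) x) = g (Suc n) x)"
    if "good n f" for n f
  proof -
    have f: "f \<in> khom H (P n) (B (Suc n))"
      and Ef: "\<And>x. x \<in> mcarrier (P (Suc n)) \<Longrightarrow> E n (f (dP (Suc n) x)) = g n (dP (Suc n) x)"
      using that by (auto simp: good_def)
    let ?c = "\<lambda>x. g (Suc n) x - f (dP (Suc n) x)"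
    have c: "?c \<in> khom H (P (Suc n)) (B (Suc n))"
      by (rule khom_minus[OF g khom_comp[OF d f] B])
    have "?c ` mcarrier (P (Suc n)) \<subseteq> E (Suc n) ` mcarrier (B (Suc (Suc n)))"
    proof
      fix y assume "y \<in> ?c ` mcarrier (P (Suc n))"
      then obtain x where x: "x \<in> mcarrier (P (Suc n))" "y = ?c x" by blast
      have "E n y = E n (g (Suc n) x) - E n (f (dP (Suc n) x))"
        unfolding x(2) by (rule khom_diff[OF E B khom_mem[OF g x(1)] khom_mem[OF f khom_mem[OF d x(1)]]])
      then have "E n y = 0" using chain Ef x(1) by simp
      then show "y \<in> E (Suc n) ` mcarrier (B (Suc (Suc n)))"
        using exact khom_mem[OF c x(1)] x(2) by blast
    qed
    then obtain f' where f': "f' \<in> khom H (P (Suc n)) (B (Suc (Suc n)))"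
      "\<And>x. x \<in> mcarrier (P (Suc n)) \<Longrightarrow> E (Suc n) (f' x) = ?c x"
      using lift[OF B c E] by blast
    have "E (Suc n) (f' (dP (Suc (Suc n)) x)) = g (Suc n) (dP (Suc (Suc n)) x)"
      if "x \<in> mcarrier (P (Suc (Suc n)))" for x
      using f'(2)[OF khom_mem[OF d that]] resolution_diff_diff[OF P that] khom_zero[OF f] by simp
    then show ?thesis using f'
      by (intro exI[of _ f']) (auto simp: good_def)
  qed
  ultimately obtain h where h: "\<And>n. good n (h n)"
    "\<And>n. \<forall>x\<in>mcarrier (P (Suc n)). E (Suc n) (h (Suc n) x) + h n (dP (Suc n) x) = g (Suc n) x"
    using dependent_nat_choice[of good "\<lambda>n f f'. \<forall>x\<in>mcarrier (P (Suc n)). E (Suc n) (f' x) + f (dP (Suc n) x) = g (Suc n) x"]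
    by metis
  show thesis
    by (rule that[of h]) (use h in \<open>auto simp: good_def\<close>)
qed

section \<open>Filtered complexes\<close>

text \<open>The map d is additive on the whole ambient type but squares to zero only on the filtered
  part. Closure under subtraction, with 0, also gives closure under negation and addition.\<close>

locale filtered_complex =
  fixes F :: "int \<Rightarrow> int \<Rightarrow> 'a::ab_group_add set" and d :: "int \<Rightarrow> 'a \<Rightarrow> 'a"
  assumes F_zero: "0 \<in> F r n"
    and F_diff: "x \<in> F r n \<Longrightarrow> y \<in> F r n \<Longrightarrow> x - y \<in> F r n"
    and F_mono: "F (r + 1) n \<subseteq> F r n"
    and d_diff: "d n (x - y) = d n x - d n y"
    and d_F: "x \<in> F r n \<Longrightarrow> d n x \<in> F r (n + 1)"
    and d_d: "x \<in> F r n \<Longrightarrow> d (n + 1) (d n x) = 0"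
begin

lemma d_zero: "d n 0 = 0"
  using d_diff[of n 0 0] by simp

lemma cycles_zero: "0 \<in> ss_cycles F d k r s"
  by (simp add: ss_cycles_def F_zero d_zero)

lemma cycles_diff: "x \<in> ss_cycles F d k r s \<Longrightarrow> y \<in> ss_cycles F d k r s \<Longrightarrow> x - y \<in> ss_cycles F d k r s"
  by (auto simp: ss_cycles_def F_diff d_diff)

lemma cycles_inner: "x \<in> ss_cycles F d (k - 1) (r + 1) (s - 1) \<Longrightarrow> x \<in> ss_cycles F d k r s"
  using F_mono[of r "r + s"] by (auto simp: ss_cycles_def algebra_simps)

lemma boundsI:
  "u \<in> ss_cycles F d (k - 1) (r + 1) (s - 1) \<Longrightarrow> w \<in> ss_cycles F d (k - 1) (r - k + 1) (s + k - 2) \<Longrightarrow>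
    u + d (r + s - 1) w \<in> ss_bounds F d k r s"
  unfolding ss_bounds_def by (blast intro: set_plus_intro)

lemma boundsE:
  assumes "x \<in> ss_bounds F d k r s"
  obtains u w where "u \<in> ss_cycles F d (k - 1) (r + 1) (s - 1)"
    "w \<in> ss_cycles F d (k - 1) (r - k + 1) (s + k - 2)" "x = u + d (r + s - 1) w"
  using assms unfolding ss_bounds_def by (auto simp: set_plus_def)

lemma bounds_zero: "0 \<in> ss_bounds F d k r s"
  using boundsI[OF cycles_zero cycles_zero, of r s k] by (simp add: d_zero)

lemma bounds_diff:
  assumes "x \<in> ss_bounds F d k r s" "y \<in> ss_bounds F d k r s"
  shows "x - y \<in> ss_bounds F d k r s"
proof -
  obtain u w where x: "u \<in> ss_cycles F d (k - 1) (r + 1) (s - 1)"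
    "w \<in> ss_cycles F d (k - 1) (r - k + 1) (s + k - 2)" "x = u + d (r + s - 1) w"
    using boundsE[OF assms(1)] .
  obtain u' w' where y: "u' \<in> ss_cycles F d (k - 1) (r + 1) (s - 1)"
    "w' \<in> ss_cycles F d (k - 1) (r - k + 1) (s + k - 2)" "y = u' + d (r + s - 1) w'"
    using boundsE[OF assms(2)] .
  have "x - y = (u - u') + d (r + s - 1) (w - w')"
    by (simp add: x(3) y(3) d_diff)
  then show ?thesis
    using boundsI[OF cycles_diff[OF x(1) y(1)] cycles_diff[OF x(2) y(2)]] by simp
qed

lemma bounds_add: "x \<in> ss_bounds F d k r s \<Longrightarrow> y \<in> ss_bounds F d k r s \<Longrightarrow> x + y \<in> ss_bounds F d k r s"
  using bounds_diff[of x k r s "0 - y"] bounds_diff[OF bounds_zero, of y k r s] by simp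

lemma bounds_cycles:
  assumes "x \<in> ss_bounds F d k r s" shows "x \<in> ss_cycles F d k r s"
proof -
  obtain u w where x: "u \<in> ss_cycles F d (k - 1) (r + 1) (s - 1)"
    "w \<in> ss_cycles F d (k - 1) (r - k + 1) (s + k - 2)" "x = u + d (r + s - 1) w"
    using boundsE[OF assms] .
  have "w \<in> F (r - k + 1) (r + s - 1)" "d (r + s - 1) w \<in> F r (r + s)"
    using x(2) by (simp_all add: ss_cycles_def algebra_simps)
  moreover have "d (r + s) (d (r + s - 1) w) = 0"
    using d_d[OF calculation(1)] by simp
  ultimately have "0 - d (r + s - 1) w \<in> ss_cycles F d k r s"
    by (intro cycles_diff[OF cycles_zero]) (simp add: ss_cycles_def F_zero)
  from cycles_diff[OF cycles_inner[OF x(1)] this] show ?thesis by (simp add: x(3))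
qed

lemma d_bounds:
  assumes "x \<in> ss_bounds F d k r s"
  shows "d (r + s) x \<in> ss_bounds F d k (r + k) (s - k + 1)"
proof -
  obtain u w where x: "u \<in> ss_cycles F d (k - 1) (r + 1) (s - 1)"
    "w \<in> ss_cycles F d (k - 1) (r - k + 1) (s + k - 2)" "x = u + d (r + s - 1) w"
    using boundsE[OF assms] .
  have "w \<in> F (r - k + 1) (r + s - 1)"
    using x(2) by (simp add: ss_cycles_def algebra_simps)
  then have dd: "d (r + s) (d (r + s - 1) w) = 0" using d_d by fastforce
  have "d (r + s) x = d (r + s) u"
    using d_diff[of "r + s" x "d (r + s - 1) w"] dd by (simp add: x(3))
  \<comment> \<open>For the target (r + k, s - k + 1), the boundary part of the bounds starts at (r
    + 1, s - 1), exactly where u lives.\<close>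
  moreover have "0 + d (r + k + (s - k + 1) - 1) u \<in> ss_bounds F d k (r + k) (s - k + 1)"
    by (rule boundsI[OF cycles_zero]) (use x(1) in \<open>simp add: algebra_simps\<close>)
  ultimately show ?thesis by simp
qed

lemma page_member:
  assumes "\<zeta> \<in> ss_page F d k r s" "x \<in> \<zeta>"
  shows "x \<in> ss_cycles F d k r s" "\<zeta> = x +o ss_bounds F d k r s"
proof -
  obtain x0 where x0: "x0 \<in> ss_cycles F d k r s" "\<zeta> = x0 +o ss_bounds F d k r s"
    using assms(1) by (auto simp: ss_page_def)
  then obtain b where b: "b \<in> ss_bounds F d k r s" "x = x0 + b"
    using assms(2) by (auto simp: elt_set_plus_def)
  have "x0 - (0 - b) \<in> ss_cycles F d k r s"
    by (intro cycles_diff cycles_zero x0(1) bounds_cycles[OF b(1)])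
  then show "x \<in> ss_cycles F d k r s" by (simp add: b(2))
  show "\<zeta> = x +o ss_bounds F d k r s"
  proof (intro equalityI subsetI)
    fix y assume "y \<in> \<zeta>"
    then obtain c where "c \<in> ss_bounds F d k r s" "y = x + (c - b)"
      by (auto simp: x0(2) elt_set_plus_def b(2))
    then show "y \<in> x +o ss_bounds F d k r s"
      using bounds_diff[OF _ b(1)] by (auto simp: elt_set_plus_def)
  next
    fix y assume "y \<in> x +o ss_bounds F d k r s"
    then obtain c where "c \<in> ss_bounds F d k r s" "y = x0 + (b + c)"
      by (auto simp: elt_set_plus_def b(2) add.assoc)
    then show "y \<in> \<zeta>"
      using bounds_add[OF b(1)] by (auto simp: x0(2) elt_set_plus_def)
  qed
qed

text \<open>Terms of deeper filtration are part of the bounds. This is the freedom that allows the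
  component in column r + 1 to be corrected without leaving the class.\<close>

lemma page_diff_inner:
  assumes "\<zeta> \<in> ss_page F d k r s" "x \<in> \<zeta>" "u \<in> ss_cycles F d (k - 1) (r + 1) (s - 1)"
  shows "x - u \<in> \<zeta>"
proof -
  have "0 - u \<in> ss_bounds F d k r s"
    using boundsI[OF assms(3) cycles_zero] by (intro bounds_diff bounds_zero) (simp add: d_zero)
  then show ?thesis
    unfolding page_member(2)[OF assms(1,2)] by (force simp: elt_set_plus_def)
qed

lemma diff_member: "x \<in> \<zeta> \<Longrightarrow> d (r + s) x \<in> ss_diff F d k r s \<zeta>"
  unfolding ss_diff_def using bounds_zero by (force simp: elt_set_plus_def)

text \<open>Two representatives differ by a bound, whose differential is a bound at the target by
  \<open>d_bounds\<close>; so the cosets in the union agree.\<close>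

lemma diff_page:
  assumes "\<zeta> \<in> ss_page F d k r s"
  shows "ss_diff F d k r s \<zeta> \<in> ss_page F d k (r + k) (s - k + 1)"
proof -
  let ?B = "ss_bounds F d k (r + k) (s - k + 1)"
  obtain x where x: "x \<in> \<zeta>" using assms bounds_zero by (force simp: ss_page_def elt_set_plus_def)
  note xm = page_member[OF assms x]
  have "d (r + s) y +o ?B = d (r + s) x +o ?B" if y: "y \<in> \<zeta>" for y
  proof -
    obtain b where b: "b \<in> ss_bounds F d k r s" "y = x + b"
      using y xm(2) by (auto simp: elt_set_plus_def)
    have db: "d (r + s) b \<in> ?B" by (rule d_bounds[OF b(1)])
    have dy: "d (r + s) y = d (r + s) x + d (r + s) b"
      using d_diff[of "r + s" y b] by (simp add: b(2) algebra_simps)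
    show ?thesis
    proof (intro equalityI subsetI)
      fix z assume "z \<in> d (r + s) y +o ?B"
      then obtain c where "c \<in> ?B" "z = d (r + s) x + (d (r + s) b + c)"
        by (auto simp: elt_set_plus_def dy add.assoc)
      then show "z \<in> d (r + s) x +o ?B"
        using bounds_add[OF db] by (auto simp: elt_set_plus_def)
    next
      fix z assume "z \<in> d (r + s) x +o ?B"
      then obtain c where "c \<in> ?B" "z = d (r + s) y + (c - d (r + s) b)"
        by (auto simp: elt_set_plus_def dy)
      then show "z \<in> d (r + s) y +o ?B"
        using bounds_diff[OF _ db] by (auto simp: elt_set_plus_def)
    qed
  qed
  then have "ss_diff F d k r s \<zeta> = d (r + s) x +o ?B"
    unfolding ss_diff_def using x by blast
  moreover have "x \<in> F r (r + s)" "d (r + s) x \<in> F (r + k) (r + s + 1)"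
    using xm(1) by (auto simp: ss_cycles_def)
  moreover have "d (r + s + 1) (d (r + s) x) = 0" using d_d calculation(2) by blast
  ultimately show ?thesis
    unfolding ss_page_def by (intro image_eqI[of _ _ "d (r + s) x"]) (auto simp: ss_cycles_def F_zero add.assoc)
qed

end

section \<open>The double complex\<close>

lemma hom_kmod_is_kmod:
  fixes G :: "('g, 'b) monoid_scheme" (structure)
  assumes M: "M \<lhd> G" and Y: "is_kmod G Y" and V: "is_kmod G V"
  shows "is_kmod G (hom_kmod G M Y V)"
proof -
  interpret normal M G by fact
  have sM: "subgroup M G" by (rule subgroup_axioms)
  note VM = is_kmod_subgrp[OF V sM]
  let ?A = "hom_kmod G M Y V"
  have vs: "vector_space (mscale ?A)"
    by unfold_locales (auto simp: hom_kmod_def fun_eq_iff kmod_scale_add[OF V]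
        kmod_scale_left_add[OF V] kmod_scale_scale[OF V] kmod_scale_one[OF V])
  interpret vector_space "mscale ?A" by (rule vs)
  have sub: "subspace (mcarrier ?A)"
    by (rule subspaceI) (auto simp: hom_kmod_def zero_fun_def plus_fun_def
        intro: khom_null[OF VM] khom_plus[OF _ _ VM] khom_mscale[OF _ VM])
  have act: "maction ?A g f \<in> mcarrier ?A" if g: "g \<in> carrier G" and f: "f \<in> mcarrier ?A" for g f
  proof -
    have f: "f \<in> khom (subgrp G M) Y V" using f by (simp add: hom_kmod_def)
    have ig: "inv g \<in> carrier G" using g by simp
    note Yg = kmod_act[OF Y ig]
    have "(\<lambda>y. if y \<in> mcarrier Y then maction V g (f (maction Y (inv g) y)) else 0) \<in> khom (subgrp G M) Y V"
    proof (rule khomI)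
      fix h y assume "h \<in> carrier (subgrp G M)" and y: "y \<in> mcarrier Y"
      then have hM: "h \<in> M" and h: "h \<in> carrier G" using subset by auto
      \<comment> \<open>Normality of M puts h' in M. It carries h past inv g, where f is M-linear,
        and becomes h again on the left of g.\<close>
      define h' where "h' = inv g \<otimes> h \<otimes> g"
      have h': "h' \<in> M" "h' \<in> carrier G" using inv_op_closed1[OF g hM] subset by (auto simp: h'_def)
      have e1: "inv g \<otimes> h = h' \<otimes> inv g" and e2: "g \<otimes> h' = h \<otimes> g"
        using g h by (simp_all add: h'_def m_assoc) (simp_all add: m_assoc[symmetric])
      have "maction Y (inv g) (maction Y h y) = maction Y h' (maction Y (inv g) y)"
        using kmod_act_mult[OF Y ig h y] kmod_act_mult[OF Y h'(2) ig y] by (simp add: e1)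
      then have "maction V g (f (maction Y (inv g) (maction Y h y)))
          = maction V g (maction V h' (f (maction Y (inv g) y)))"
        using khom_act[OF f, of h'] h' Yg[OF y] by simp
      also have "\<dots> = maction V h (maction V g (f (maction Y (inv g) y)))"
        using kmod_act_mult[OF V g h'(2)] kmod_act_mult[OF V h g] khom_mem[OF f Yg[OF y]] by (simp add: e2)
      finally show "(if maction Y h y \<in> mcarrier Y then maction V g (f (maction Y (inv g) (maction Y h y))) else 0)
        = maction V h (if y \<in> mcarrier Y then maction V g (f (maction Y (inv g) y)) else 0)"
        using y kmod_act[OF Y h y] by simp
    qed (auto simp: kmod_add[OF Y] kmod_scale[OF Y] kmod_act_add[OF Y ig] kmod_act_scale[OF Y ig] Yg
          khom_add[OF f] khom_scale[OF f] khom_mem[OF f] kmod_act[OF V g] kmod_act_add[OF V g] kmod_act_scale[OF V g])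
    then show ?thesis by (simp add: hom_kmod_def)
  qed
  show ?thesis
    unfolding is_kmod_def
  proof (intro conjI ballI allI vs sub act)
    fix h x y assume "h \<in> carrier G" "x \<in> mcarrier ?A" "y \<in> mcarrier ?A"
    then show "maction ?A h (x + y) = maction ?A h x + maction ?A h y"
      by (auto simp: hom_kmod_def fun_eq_iff kmod_act[OF Y] khom_mem kmod_act_add[OF V])
  next
    fix h c x assume "h \<in> carrier G" "x \<in> mcarrier ?A"
    then show "maction ?A h (mscale ?A c x) = mscale ?A c (maction ?A h x)"
      by (auto simp: hom_kmod_def fun_eq_iff kmod_act[OF Y] khom_mem kmod_act_scale[OF V] kmod_scale_zero[OF V])
  next
    fix x assume "x \<in> mcarrier ?A"
    then show "maction ?A \<one> x = x"
      by (auto simp: hom_kmod_def fun_eq_iff kmod_act_one[OF Y] kmod_act_one[OF V] khom_mem khom_out)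
  next
    fix g h x assume "g \<in> carrier G" "h \<in> carrier G" "x \<in> mcarrier ?A"
    then show "maction ?A (g \<otimes> h) x = maction ?A g (maction ?A h x)"
      by (auto simp: hom_kmod_def fun_eq_iff kmod_act[OF Y] khom_mem kmod_act_mult[OF V]
          inv_mult_group kmod_act_mult[OF Y])
  qed
qed

lemma hom_kmod_precomp:
  fixes G :: "('g, 'b) monoid_scheme" (structure)
  assumes G: "group G" and M: "subgroup M G" and A: "is_kmod G (hom_kmod G M Y V)"
    and Y: "is_kmod G Y" and V: "is_kmod G V"
    and e: "e \<in> khom G Y' Y" and H: "subgroup H G"
  shows "(\<lambda>f. if f \<in> mcarrier (hom_kmod G M Y V) then (\<lambda>y. f (e y)) else 0)
    \<in> khom (subgrp G H) (hom_kmod G M Y V) (hom_kmod G M Y' V)"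
proof -
  interpret group G by fact
  have HG: "h \<in> carrier G" if "h \<in> carrier (subgrp G H)" for h
    using that subgroup.subset[OF H] by auto
  have A: "is_kmod (subgrp G H) (hom_kmod G M Y V)"
    by (rule is_kmod_subgrp[OF A H])
  note eM = khom_subgrp[OF e M]
  show ?thesis
  proof (rule khomI)
    fix f assume "f \<in> mcarrier (hom_kmod G M Y V)"
    then show "(if f \<in> mcarrier (hom_kmod G M Y V) then \<lambda>y. f (e y) else 0) \<in> mcarrier (hom_kmod G M Y' V)"
      using khom_comp[OF eM] by (simp add: hom_kmod_def)
  next
    fix h f assume h: "h \<in> carrier (subgrp G H)" and f: "f \<in> mcarrier (hom_kmod G M Y V)"
    note hG = HG[OF h]
    have "maction (hom_kmod G M Y V) h f (e y) = maction (hom_kmod G M Y' V) h (\<lambda>y. f (e y)) y" for y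
    proof (cases "y \<in> mcarrier Y'")
      case True
      then show ?thesis
        using khom_mem[OF e True] khom_act[OF e _ True, of "inv h"] hG by (simp add: hom_kmod_def)
    next
      case False
      \<comment> \<open>Here e y = 0, which lies in the carrier of Y, so the left side vanishes by
        linearity and not by the default value.\<close>
      have "maction V h (f (maction Y (inv h) 0)) = 0"
        using f kmod_act_zero[OF Y, of "inv h"] kmod_act_zero[OF V hG] hG
        by (simp add: hom_kmod_def khom_zero)
      then show ?thesis using False khom_out[OF e False] by (simp add: hom_kmod_def)
    qed
    then show "(if maction (hom_kmod G M Y V) h f \<in> mcarrier (hom_kmod G M Y V)
        then \<lambda>y. maction (hom_kmod G M Y V) h f (e y) else 0)
      = maction (hom_kmod G M Y' V) h (if f \<in> mcarrier (hom_kmod G M Y V) then \<lambda>y. f (e y) else 0)"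
      using f kmod_act[OF A h f] by simp
  next
    fix f g assume "f \<in> mcarrier (hom_kmod G M Y V)" "g \<in> mcarrier (hom_kmod G M Y V)"
    then show "(if f + g \<in> mcarrier (hom_kmod G M Y V) then \<lambda>y. (f + g) (e y) else 0)
      = (if f \<in> mcarrier (hom_kmod G M Y V) then \<lambda>y. f (e y) else 0)
        + (if g \<in> mcarrier (hom_kmod G M Y V) then \<lambda>y. g (e y) else 0)"
      by (simp add: kmod_add[OF A] fun_eq_iff)
  next
    fix c f assume f: "f \<in> mcarrier (hom_kmod G M Y V)"
    then show "(if mscale (hom_kmod G M Y V) c f \<in> mcarrier (hom_kmod G M Y V)
        then \<lambda>y. mscale (hom_kmod G M Y V) c f (e y) else 0)
      = mscale (hom_kmod G M Y' V) c (if f \<in> mcarrier (hom_kmod G M Y V) then \<lambda>y. f (e y) else 0)"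
      using kmod_scale[OF A f, of c] by (simp add: hom_kmod_def)
  qed simp
qed

section \<open>The cyclic resolution and the entries of the double complex\<close>

locale lhs_data = group G for G :: "('g, 'b) monoid_scheme" (structure) +
  fixes M :: "'g set" and \<sigma> :: 'g and V :: "('k::field, 'g, 'v::ab_group_add) kmod"
    and Y :: "nat \<Rightarrow> ('k, 'g, 'y::ab_group_add) kmod" and dY :: "nat \<Rightarrow> 'y \<Rightarrow> 'y" and \<epsilon>Y :: "'y \<Rightarrow> 'k"
  assumes \<sigma>: "\<sigma> \<in> carrier G" and M: "M \<lhd> G" and V: "is_kmod G V"
    and V_trivial: "\<And>h v. h \<in> M \<Longrightarrow> v \<in> mcarrier V \<Longrightarrow> maction V h v = v"
    and Y: "projective_resolution G Y dY \<epsilon>Y"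
begin

abbreviation Q where "Q \<equiv> generate G {\<sigma>}"
abbreviation q where "q \<equiv> card Q"
abbreviation Z :: "('k, 'g, unit \<times> 'g \<Rightarrow> 'k) kmod" where "Z \<equiv> cyc_mod G \<sigma>"
abbreviation HomY where "HomY j \<equiv> hom_kmod G M (Y j) V"
abbreviation e :: "unit \<times> 'g \<Rightarrow> 'k" where "e \<equiv> cyc_gen G"
abbreviation dZ :: "nat \<Rightarrow> (unit \<times> 'g \<Rightarrow> 'k) \<Rightarrow> unit \<times> 'g \<Rightarrow> 'k" where "dZ \<equiv> cyc_diff G \<sigma>"

lemma M_subgroup: "subgroup M G"
  using M by (rule normal_imp_subgroup)

lemma Q_subgroup: "subgroup Q G"
  using \<sigma> by (simp add: generate_is_subgroup)

lemma Q_group: "group (subgrp G Q)"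
  by (rule subgroup_imp_group[OF Q_subgroup])

lemma \<sigma>_pow_Q: "\<sigma> [^] (i::nat) \<in> Q"
proof (induction i)
  case (Suc i)
  then show ?case
    using subgroup.m_closed[OF Q_subgroup Suc] generate.incl[of \<sigma> "{\<sigma>}" G] by simp
qed (simp add: subgroup.one_closed[OF Q_subgroup])

lemma \<sigma>_Q: "\<sigma> \<in> Q"
  by (simp add: generate.incl)

lemma \<sigma>_pow_card: "\<sigma> [^] q = \<one>"
  using generate_pow_card[OF \<sigma>] pow_ord_eq_1[OF \<sigma>] by simp

lemma Q_commute: "h \<in> Q \<Longrightarrow> \<sigma> [^] (i::nat) \<otimes> h = h \<otimes> \<sigma> [^] i"
proof -
  assume "h \<in> Q"
  then obtain k :: int where "h = \<sigma> [^] k" using generate_pow[OF \<sigma>] by auto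
  then show ?thesis
    using int_pow_mult[OF \<sigma>, of "int i" k] int_pow_mult[OF \<sigma>, of k "int i"] by (simp add: add.commute int_pow_int)
qed

lemma Y_kmod: "is_kmod G (Y j)" by (rule resolution_kmod[OF Y])

lemma HomY_kmod: "is_kmod G (HomY j)" by (rule hom_kmod_is_kmod[OF M Y_kmod V])

lemma HomY_kmod_Q: "is_kmod (subgrp G Q) (HomY j)" by (rule is_kmod_subgrp[OF HomY_kmod Q_subgroup])

lemma V_kmod_M: "is_kmod (subgrp G M) V" by (rule is_kmod_subgrp[OF V M_subgroup])

lemma Z_kmod: "is_kmod (subgrp G Q) Z" by (rule free_kmod_is_kmod[OF Q_group])

lemma HomY_carrier: "mcarrier (HomY j) = khom (subgrp G M) (Y j) V" by (simp add: hom_kmod_def)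

lemma e_basis: "e = free_basis ((), \<one>)"
  by (auto simp: cyc_gen_def free_basis_def fun_eq_iff)

lemma e_mem: "e \<in> mcarrier Z"
  unfolding e_basis using subgroup.one_closed[OF Q_subgroup] by (intro free_basis_mem) auto

lemma basis_e: "g \<in> Q \<Longrightarrow> free_basis ((), g) = maction Z g e"
  unfolding e_basis using subgroup.one_closed[OF Q_subgroup] subgroup.subset[OF Q_subgroup]
  by (subst free_basis_act[OF Q_group]) auto

text \<open>Z is free of rank one on \<open>e\<close>. Together with \<open>entry_exists\<close>
  this identifies an entry with Hom_M (Y_j, V) by evaluation at \<open>e\<close>.\<close>

lemma entry_eq_zero:
  assumes X: "X \<in> lhs_entry G M \<sigma> Y V j" and X0: "X e = 0"
  shows "X = 0"
proof
  fix \<phi>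
  note X = X[unfolded lhs_entry_def]
  show "X \<phi> = 0 \<phi>"
  proof (cases "\<phi> \<in> mcarrier Z")
    case True
    have "X (free_basis z) = 0" if "\<phi> z \<noteq> 0" for z
    proof -
      define g where "g = snd z"
      have g: "z = ((), g)" "g \<in> Q"
        using True that by (auto simp: free_kmod_def g_def prod_eq_iff)
      show ?thesis
        using khom_act[OF X _ e_mem, of g] g X0 kmod_act_zero[OF HomY_kmod_Q, of g] by (simp add: basis_e)
    qed
    then show ?thesis
      unfolding khom_free_expand[OF Q_group X True] by (simp add: kmod_scale_zero[OF HomY_kmod_Q])
  next
    case False
    then show ?thesis using khom_out[OF X] by simp
  qed
qed

lemma entry_exists:
  assumes c: "c \<in> khom (subgrp G M) (Y j) V"
  obtains X where "X \<in> lhs_entry G M \<sigma> Y V j" "X e = c"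
proof -
  have cA: "c \<in> mcarrier (HomY j)" using c by (simp add: HomY_carrier)
  obtain X where "X \<in> khom (subgrp G Q) Z (HomY j)"
    "\<And>i g. i \<in> {()} \<Longrightarrow> g \<in> Q \<Longrightarrow> X (free_basis (i, g)) = maction (HomY j) g c"
    using free_kmod_extend[OF Q_group group.subgroup_self[OF Q_group], of "HomY j" "{()}" "\<lambda>(i, g). maction (HomY j) g c"]
      HomY_kmod_Q kmod_act[OF HomY_kmod_Q _ cA] kmod_act_mult[OF HomY_kmod_Q _ _ cA] by auto
  then show thesis
    using that[of X] subgroup.one_closed[OF Q_subgroup] kmod_act_one[OF HomY_kmod cA]
    by (simp add: lhs_entry_def e_basis)
qed

text \<open>Invariance of the norm: each sum, completed by x, is the sum over q + 1 consecutive
  powers, because \<sigma>^q = 1.\<close>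

lemma sum_\<sigma>_shift:
  assumes "is_kmod (subgrp G Q) B" "x \<in> mcarrier B"
  shows "(\<Sum>i<q. maction B (\<sigma> [^] Suc i) x) = (\<Sum>i<q. maction B (\<sigma> [^] i) x)"
proof -
  have "(\<Sum>i<q. maction B (\<sigma> [^] Suc i) x) + x = (\<Sum>i<Suc q. maction B (\<sigma> [^] i) x)"
    unfolding sum.lessThan_Suc_shift using kmod_act_one[OF assms] by (simp add: add.commute)
  also have "\<dots> = (\<Sum>i<q. maction B (\<sigma> [^] i) x) + x"
    using kmod_act_one[OF assms] by (simp add: \<sigma>_pow_card)
  finally show ?thesis by simp
qed

lemma cyc_diff_out: "\<phi> \<notin> mcarrier Z \<Longrightarrow> dZ k \<phi> = 0"
  by (simp add: cyc_diff_def)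

lemma cyc_diff_odd: "odd k \<Longrightarrow> \<phi> \<in> mcarrier Z \<Longrightarrow> dZ k \<phi> = maction Z \<sigma> \<phi> - \<phi>"
  by (auto simp: cyc_diff_def odd_pos)

lemma cyc_diff_even: "even k \<Longrightarrow> k > 0 \<Longrightarrow> \<phi> \<in> mcarrier Z \<Longrightarrow> dZ k \<phi> = (\<Sum>i<q. maction Z (\<sigma> [^] i) \<phi>)"
  by (auto simp: cyc_diff_def)

text \<open>Elements of Q commute with powers of its generator; this makes the differentials of Z
  linear over Q.\<close>

lemma \<sigma>_pow_act_khom:
  "(\<lambda>\<phi>. if \<phi> \<in> mcarrier Z then maction Z (\<sigma> [^] (i::nat)) \<phi> else 0) \<in> khom (subgrp G Q) Z Z"
proof (rule khomI)
  note s = \<sigma>_pow_Q[of i]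
  fix h \<phi> assume h: "h \<in> carrier (subgrp G Q)" and \<phi>: "\<phi> \<in> mcarrier Z"
  have "maction Z (\<sigma> [^] i) (maction Z h \<phi>) = maction Z h (maction Z (\<sigma> [^] i) \<phi>)"
    using kmod_act_mult[OF Z_kmod, of "\<sigma> [^] i" h \<phi>] kmod_act_mult[OF Z_kmod, of h "\<sigma> [^] i" \<phi>]
      s h \<phi> Q_commute[of h i] by simp
  then show "(if maction Z h \<phi> \<in> mcarrier Z then maction Z (\<sigma> [^] i) (maction Z h \<phi>) else 0)
      = maction Z h (if \<phi> \<in> mcarrier Z then maction Z (\<sigma> [^] i) \<phi> else 0)"
    using \<phi> kmod_act[OF Z_kmod h \<phi>] by simp
qed (use \<sigma>_pow_Q[of i] in \<open>auto simp: kmod_add[OF Z_kmod] kmod_scale[OF Z_kmod] kmod_act[OF Z_kmod]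
    kmod_act_add[OF Z_kmod] kmod_act_scale[OF Z_kmod]\<close>)

lemma cyc_diff_khom: "dZ k \<in> khom (subgrp G Q) Z Z"
proof -
  consider "k = 0" | "odd k" | "even k" "k > 0" by auto
  then show ?thesis
  proof cases
    case 1
    then have "dZ k = (\<lambda>_. 0)" by (simp add: cyc_diff_def fun_eq_iff)
    then show ?thesis using khom_null[OF Z_kmod] by simp
  next
    case 2
    have "dZ k = (\<lambda>\<phi>. (if \<phi> \<in> mcarrier Z then maction Z (\<sigma> [^] (1::nat)) \<phi> else 0)
        - (if \<phi> \<in> mcarrier Z then \<phi> else 0))"
      using 2 \<sigma> by (auto simp: fun_eq_iff cyc_diff_odd cyc_diff_out)
    then show ?thesis using khom_minus[OF \<sigma>_pow_act_khom khom_id[OF Z_kmod] Z_kmod] by simp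
  next
    case 3
    have "dZ k = (\<lambda>\<phi>. \<Sum>i<q. if \<phi> \<in> mcarrier Z then maction Z (\<sigma> [^] i) \<phi> else 0)"
    proof
      fix \<phi> show "dZ k \<phi> = (\<Sum>i<q. if \<phi> \<in> mcarrier Z then maction Z (\<sigma> [^] i) \<phi> else 0)"
        using 3 by (cases "\<phi> \<in> mcarrier Z") (simp_all add: cyc_diff_even cyc_diff_out)
    qed
    then show ?thesis using khom_setsum[OF \<sigma>_pow_act_khom Z_kmod] by simp
  qed
qed

text \<open>In positive degrees this is (\<sigma> - 1) N = 0 = N (\<sigma> - 1), and both follow
  from the shift of the norm.\<close>

lemma cyc_diff_diff: "dZ i (dZ (Suc i) \<phi>) = 0"
proof (cases "\<phi> \<in> mcarrier Z \<and> i > 0")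
  case True
  note Zd = khom_mem[OF cyc_diff_khom]
  have \<phi>: "\<phi> \<in> mcarrier Z" using True by simp
  have s\<phi>: "maction Z \<sigma> \<phi> \<in> mcarrier Z" using kmod_act[OF Z_kmod _ \<phi>, of \<sigma>] \<sigma>_Q by simp
  have mult: "maction Z (\<sigma> [^] Suc j) \<phi> = maction Z (\<sigma> [^] j) (maction Z \<sigma> \<phi>)" for j
    using kmod_act_mult[OF Z_kmod _ _ \<phi>, of "\<sigma> [^] j" \<sigma>] \<sigma>_Q \<sigma>_pow_Q by simp
  have mult': "maction Z (\<sigma> [^] Suc j) \<phi> = maction Z \<sigma> (maction Z (\<sigma> [^] j) \<phi>)" for j
    using kmod_act_mult[OF Z_kmod _ _ \<phi>, of \<sigma> "\<sigma> [^] j"] \<sigma>_Q \<sigma>_pow_Q Q_commute[OF \<sigma>_Q, of j] by simp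
  have Zj: "maction Z (\<sigma> [^] j) \<phi> \<in> mcarrier Z" for j :: nat
    using kmod_act[OF Z_kmod _ \<phi>] \<sigma>_pow_Q by simp
  note shift = sum_\<sigma>_shift[OF Z_kmod \<phi>]
  show ?thesis
  proof (cases "odd i")
    case odd: True
    have "dZ i (dZ (Suc i) \<phi>) = maction Z \<sigma> (\<Sum>j<q. maction Z (\<sigma> [^] j) \<phi>) - (\<Sum>j<q. maction Z (\<sigma> [^] j) \<phi>)"
      using cyc_diff_odd[OF odd Zd[OF \<phi>, of "Suc i"]] cyc_diff_even[of "Suc i" \<phi>] odd \<phi> by simp
    also have "maction Z \<sigma> (\<Sum>j<q. maction Z (\<sigma> [^] j) \<phi>) = (\<Sum>j<q. maction Z (\<sigma> [^] Suc j) \<phi>)"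
      unfolding mult' by (rule kmod_act_sum[OF Z_kmod]) (use \<sigma>_Q Zj in auto)
    finally show ?thesis using shift by (simp only: diff_self)
  next
    case even: False
    have "dZ i (dZ (Suc i) \<phi>) = (\<Sum>j<q. maction Z (\<sigma> [^] j) (maction Z \<sigma> \<phi> - \<phi>))"
      using cyc_diff_even[OF _ _ Zd[OF \<phi>, of "Suc i"]] cyc_diff_odd[of "Suc i" \<phi>] even \<phi> True by simp
    also have "\<dots> = (\<Sum>j<q. maction Z (\<sigma> [^] Suc j) \<phi> - maction Z (\<sigma> [^] j) \<phi>)"
      unfolding mult using \<sigma>_pow_Q by (intro sum.cong kmod_act_diff[OF Z_kmod _ s\<phi> \<phi>]) auto
    finally show ?thesis using shift by (simp only: sum_subtractf diff_self)
  qed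
qed (auto simp: cyc_diff_out khom_zero[OF cyc_diff_khom] cyc_diff_def[of _ _ 0])

text \<open>Evaluation at \<open>e\<close> turns the horizontal differentials into the operators T -
  1, here, and N, in \<open>entry_diff_even\<close>.\<close>

lemma entry_diff_odd:
  assumes X: "X \<in> lhs_entry G M \<sigma> Y V j" and "odd k"
  shows "X (dZ k e) = maction (HomY j) \<sigma> (X e) - X e"
  using khom_act[OF X[unfolded lhs_entry_def] _ e_mem, of \<sigma>] \<sigma>_Q kmod_act[OF Z_kmod _ e_mem, of \<sigma>]
  by (simp add: cyc_diff_odd[OF assms(2) e_mem] khom_diff[OF X[unfolded lhs_entry_def] Z_kmod _ e_mem])

lemma entry_diff_even:
  assumes X: "X \<in> lhs_entry G M \<sigma> Y V j" and k: "even k" "k > 0"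
  shows "X (dZ k e) = (\<Sum>i<q. maction (HomY j) (\<sigma> [^] i) (X e))"
proof -
  note X = X[unfolded lhs_entry_def]
  have "X (dZ k e) = (\<Sum>i<q. X (maction Z (\<sigma> [^] i) e))"
    unfolding cyc_diff_even[OF k e_mem]
    by (rule khom_sum[OF X Z_kmod]) (use kmod_act[OF Z_kmod _ e_mem] \<sigma>_pow_Q in auto)
  also have "\<dots> = (\<Sum>i<q. maction (HomY j) (\<sigma> [^] i) (X e))"
    using khom_act[OF X _ e_mem] \<sigma>_pow_Q by auto
  finally show ?thesis .
qed

section \<open>The filtration and the total differential\<close>

abbreviation "FF \<equiv> lhs_filtration G M \<sigma> Y V"
abbreviation "dd \<equiv> lhs_diff G \<sigma> dY V"
abbreviation "entry j \<equiv> lhs_entry G M \<sigma> Y V j"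

lemma entry_val: assumes "X \<in> entry j" shows "X \<phi> \<in> khom (subgrp G M) (Y j) V"
  using khom_mem'[OF assms[unfolded lhs_entry_def] HomY_kmod_Q] by (simp add: HomY_carrier)

lemma entry_zero: assumes "X \<in> entry j" shows "X 0 = 0"
  by (rule khom_zero[OF assms[unfolded lhs_entry_def]])

lemma FF_entry: "x \<in> FF r n \<Longrightarrow> int i \<le> n \<Longrightarrow> x i \<in> entry (nat (n - int i))"
  and FF_above: "x \<in> FF r n \<Longrightarrow> int i > n \<Longrightarrow> x i = 0"
  and FF_below: "x \<in> FF r n \<Longrightarrow> int i < r \<Longrightarrow> x i = 0"
  by (auto simp: lhs_filtration_def)

lemma FF_at_zero: "x \<in> FF r n \<Longrightarrow> x i 0 = 0"
  using FF_entry[of x r n i] FF_above[of x r n i] entry_zero by (cases "int i \<le> n") auto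

lemma dY_khom: "dY (Suc j) \<in> khom G (Y (Suc j)) (Y j)"
  by (rule resolution_diff[OF Y])

lemma dY_dY: "dY j (dY (Suc j) y) = 0"
proof (cases "y \<in> mcarrier (Y (Suc j))")
  case True
  then show ?thesis by (rule resolution_diff_diff[OF Y])
next
  case False
  have "dY 0 = 0" using Y by (simp add: projective_resolution_def chain_complex_def)
  then show ?thesis
    using khom_out[OF dY_khom False] khom_zero[OF dY_khom] by (cases j) auto
qed

lemma entry_horizontal: "X \<in> entry j \<Longrightarrow> (\<lambda>\<phi>. X (dZ i \<phi>)) \<in> entry j"
  unfolding lhs_entry_def by (rule khom_comp[OF cyc_diff_khom])

lemma entry_vertical:
  assumes X: "X \<in> entry j" shows "(\<lambda>\<phi> y. mscale V c (X \<phi> (dY (Suc j) y))) \<in> entry (Suc j)"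
proof -
  have "(\<lambda>\<phi>. mscale (HomY (Suc j)) c (if X \<phi> \<in> mcarrier (HomY j) then (\<lambda>y. X \<phi> (dY (Suc j) y)) else 0)) \<in> entry (Suc j)"
    unfolding lhs_entry_def
    by (rule khom_mscale[OF khom_comp[OF X[unfolded lhs_entry_def]
          hom_kmod_precomp[OF group_axioms M_subgroup HomY_kmod Y_kmod V dY_khom Q_subgroup]] HomY_kmod_Q])
  moreover have "X \<phi> \<in> mcarrier (HomY j)" for \<phi> using entry_val[OF X] by (simp add: HomY_carrier)
  ultimately show ?thesis by (simp add: hom_kmod_def)
qed

lemma entry_plus: "X \<in> entry j \<Longrightarrow> X' \<in> entry j \<Longrightarrow> (\<lambda>\<phi>. X \<phi> + X' \<phi>) \<in> entry j"
  unfolding lhs_entry_def by (rule khom_plus[OF _ _ HomY_kmod_Q])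

lemma zero_entry: "0 \<in> entry j"
  using khom_null[OF HomY_kmod_Q] by (simp add: lhs_entry_def zero_fun_def)

lemma zero_entry': "(\<lambda>\<phi> y. 0) \<in> entry j"
  using zero_entry[of j] by (simp add: zero_fun_def)

lemma lhs_diff_FF:
  assumes x: "x \<in> FF r n" shows "dd n x \<in> FF r (n + 1)"
proof -
  have main: "dd n x i \<in> entry (nat (n + 1 - int i))" if i: "int i \<le> n + 1" for i
  proof -
    have 1: "(\<lambda>\<phi> y. if i = 0 then 0 else x (i - 1) (dZ i \<phi>) y) \<in> entry (nat (n + 1 - int i))"
    proof (cases i)
      case (Suc j)
      then have "x j \<in> entry (nat (n + 1 - int i))"
        using FF_entry[OF x, of j] i by (simp add: algebra_simps)
      then show ?thesis using entry_horizontal Suc by simp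
    qed (simp add: zero_entry')
    have 2: "(\<lambda>\<phi> y. mscale V ((-1) ^ i) (x i \<phi> (dY (nat (n - int i) + 1) y))) \<in> entry (nat (n + 1 - int i))"
    proof (cases "int i \<le> n")
      case True
      then have "nat (n + 1 - int i) = Suc (nat (n - int i))" by simp
      then show ?thesis using entry_vertical[OF FF_entry[OF x True]] by simp
    next
      \<comment> \<open>In column n + 1 the truncated degree \<open>nat (n - int i)\<close> names a
        wrong differential, but the component of x there is 0.\<close>
      case False
      then show ?thesis using FF_above[OF x, of i] zero_entry' by (simp add: kmod_scale_zero[OF V])
    qed
    show ?thesis
      using entry_plus[OF 1 2] by (simp add: lhs_diff_def plus_fun_def)
  qed
  have van: "dd n x i = 0" if "x i = 0" "i > 0 \<Longrightarrow> x (i - 1) = 0" for i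
    using that by (auto simp: lhs_diff_def fun_eq_iff kmod_scale_zero[OF V])
  show ?thesis
    unfolding lhs_filtration_def
  proof (intro CollectI allI conjI impI)
    fix i
    show "dd n x i = 0" if "int i > n + 1" by (rule van) (use that in \<open>auto intro!: FF_above[OF x]\<close>)
    show "dd n x i = 0" if "int i < r" by (rule van) (use that in \<open>auto intro!: FF_below[OF x]\<close>)
  qed (rule main)
qed

text \<open>The purely horizontal and purely vertical terms vanish separately. The two mixed terms
  carry the signs of the columns j and j + 1 and cancel.\<close>

lemma lhs_diff_diff:
  assumes x: "x \<in> FF r n" shows "dd (n + 1) (dd n x) = 0"
proof -
  have vv: "x i \<phi> (dY (nat (n - int i) + 1) (dY (nat (n + 1 - int i) + 1) y)) = 0" for i \<phi> y
  proof (cases "int i \<le> n")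
    case True
    then have "nat (n + 1 - int i) + 1 = Suc (nat (n - int i) + 1)" by simp
    then show ?thesis
      using dY_dY[of "nat (n - int i) + 1"] khom_zero[OF entry_val[OF FF_entry[OF x True]]] by simp
  qed (use FF_above[OF x, of i] in simp)
  show ?thesis
  proof (intro ext)
    fix i \<phi> y
    show "dd (n + 1) (dd n x) i \<phi> y = 0 i \<phi> y"
    proof (cases i)
      case 0
      then show ?thesis using vv[of 0] by (simp add: lhs_diff_def kmod_scale_zero[OF V])
    next
      case (Suc j)
      have "dd n x j (dZ i \<phi>) y = mscale V ((-1) ^ j) (x j (dZ i \<phi>) (dY (nat (n - int j) + 1) y))"
        using cyc_diff_diff[of j \<phi>] FF_at_zero[OF x] by (simp add: lhs_diff_def Suc)
      moreover have "dd n x i \<phi> (dY (nat (n + 1 - int i) + 1) y)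
          = x j (dZ i \<phi>) (dY (nat (n - int j) + 1) y)"
        using vv[of i \<phi> y] by (simp add: lhs_diff_def Suc kmod_scale_zero[OF V])
      ultimately show ?thesis
        by (simp add: lhs_diff_def[of _ _ _ _ "n + 1"] Suc kmod_scale_left_minus[OF V])
    qed
  qed
qed

sublocale filtered_complex FF dd
proof
  show "0 \<in> FF r n" for r n by (simp add: lhs_filtration_def zero_entry)
  show "x - y \<in> FF r n" if "x \<in> FF r n" "y \<in> FF r n" for x y r n
  proof -
    have "x i - y i \<in> entry (nat (n - int i))" if "int i \<le> n" for i
      using khom_minus[OF FF_entry[OF \<open>x \<in> FF r n\<close> that, unfolded lhs_entry_def]
          FF_entry[OF \<open>y \<in> FF r n\<close> that, unfolded lhs_entry_def] HomY_kmod_Q]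
      by (simp add: lhs_entry_def fun_diff_def)
    then show ?thesis using that by (simp add: lhs_filtration_def)
  qed
  show "FF (r + 1) n \<subseteq> FF r n" for r n by (auto simp: lhs_filtration_def)
  show "dd n (x - y) = dd n x - dd n y" for n x y
    by (simp add: lhs_diff_def fun_eq_iff kmod_scale_diff[OF V])
  show "dd n x \<in> FF r (n + 1)" if "x \<in> FF r n" for x r n using lhs_diff_FF[OF that] .
  show "dd (n + 1) (dd n x) = 0" if "x \<in> FF r n" for x r n using lhs_diff_diff[OF that] .
qed

text \<open>The vertical differential of X vanishes once it does so at \<open>e\<close>, so the
  total differential starts only in column r + 2. This supplies the cochains that
  \<open>page_diff_inner\<close> may subtract.\<close>

lemma cocycle_single:
  assumes X: "X \<in> entry k" and coc: "\<And>y. X e (dY (Suc k) y) = 0"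
  shows "(\<lambda>i. if i = Suc r then X else 0) \<in> ss_cycles FF dd 1 (int r + 1) (int k)"
proof -
  let ?C = "\<lambda>i. if i = Suc r then X else 0"
  have C: "?C \<in> FF (int r + 1) (int r + 1 + int k)"
    using X zero_entry by (auto simp: lhs_filtration_def)
  have "(\<lambda>\<phi> y. mscale V ((-1) ^ Suc r) (X \<phi> (dY (Suc k) y))) = 0"
    by (rule entry_eq_zero[OF entry_vertical[OF X]]) (simp add: coc fun_eq_iff kmod_scale_zero[OF V])
  then have van: "dd (int r + 1 + int k) ?C (Suc r) = 0"
    by (simp add: lhs_diff_def fun_eq_iff)
  note dC = d_F[OF C]
  have "dd (int r + 1 + int k) ?C i = 0" if "int i < int r + 1 + 1" for i
    using that van FF_below[OF dC, of i] by (cases "i = Suc r") auto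
  with dC have "dd (int r + 1 + int k) ?C \<in> FF (int r + 1 + 1) (int r + 1 + int k + 1)"
    by (simp add: lhs_filtration_def)
  with C show ?thesis by (simp add: ss_cycles_def)
qed

end

section \<open>Twisted homomorphisms and homotopies\<close>

context lhs_data begin

text \<open>These maps satisfy f (h x) = (g h inv g) f x for h in M. For g = \<gamma> this is the
  semilinearity of \<alpha>; the action of g on a G-module is another example, and under composition
  the twists multiply.\<close>

abbreviation "shom g A B \<equiv> khom (subgrp G M) A (twist G g B)"
abbreviation \<gamma> where "\<gamma> \<equiv> inv \<sigma>"

lemma twist_simps [simp]: "mcarrier (twist G g B) = mcarrier B" "mscale (twist G g B) = mscale B"
  "maction (twist G g B) h = maction B (g \<otimes> h \<otimes> inv g)"
  by (simp_all add: twist_def)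

lemma M_carrier: "h \<in> M \<Longrightarrow> h \<in> carrier G"
  using subgroup.subset[OF M_subgroup] by auto

lemma M_conj: "g \<in> carrier G \<Longrightarrow> h \<in> M \<Longrightarrow> g \<otimes> h \<otimes> inv g \<in> M"
  using normal.inv_op_closed2[OF M] .

lemma conj_mult:
  "g \<in> carrier G \<Longrightarrow> g' \<in> carrier G \<Longrightarrow> h \<in> carrier G \<Longrightarrow>
    g' \<otimes> (g \<otimes> h \<otimes> inv g) \<otimes> inv g' = g' \<otimes> g \<otimes> h \<otimes> inv (g' \<otimes> g)"
  by (simp add: inv_mult_group m_assoc)

lemma is_kmod_twist:
  assumes B: "is_kmod (subgrp G M) B" and g: "g \<in> carrier G"
  shows "is_kmod (subgrp G M) (twist G g B)"
proof -
  have "g \<otimes> (h \<otimes> h') \<otimes> inv g = (g \<otimes> h \<otimes> inv g) \<otimes> (g \<otimes> h' \<otimes> inv g)" if "h \<in> M" "h' \<in> M" for h h'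
    using that M_carrier g by (simp add: m_assoc) (simp add: m_assoc[symmetric])
  then show ?thesis
    using B M_conj[OF g] g unfolding is_kmod_def by simp
qed

lemma khom_twist:
  "f \<in> khom (subgrp G M) A B \<Longrightarrow> g \<in> carrier G \<Longrightarrow> f \<in> khom (subgrp G M) (twist G g A) (twist G g B)"
  using M_conj by (simp add: khom_def)

lemma shom_one: "shom \<one> A B = khom (subgrp G M) A B"
  using M_carrier by (simp add: khom_def)

lemma shom_comp:
  assumes f: "f \<in> shom g A B" and f': "f' \<in> shom g' B C" and g: "g \<in> carrier G" "g' \<in> carrier G"
  shows "(\<lambda>x. f' (f x)) \<in> shom (g' \<otimes> g) A C"
proof (rule khomI)
  fix h x assume h: "h \<in> carrier (subgrp G M)" and x: "x \<in> mcarrier A"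
  then have h': "h \<in> M" "h \<in> carrier G" using M_carrier by auto
  have "f' (f (maction A h x)) = f' (maction B (g \<otimes> h \<otimes> inv g) (f x))"
    using khom_act[OF f h x] by simp
  also have "\<dots> = maction (twist G g' C) (g \<otimes> h \<otimes> inv g) (f' (f x))"
    using khom_act[OF f', of "g \<otimes> h \<otimes> inv g" "f x"] M_conj[OF g(1) h'(1)] khom_mem[OF f x] by simp
  also have "\<dots> = maction (twist G (g' \<otimes> g) C) h (f' (f x))"
    using conj_mult[OF g h'(2)] by simp
  finally show "f' (f (maction A h x)) = maction (twist G (g' \<otimes> g) C) h (f' (f x))" .
qed (use khom_mem[OF f] khom_mem[OF f'] khom_add[OF f] khom_add[OF f'] khom_scale[OF f] khom_scale[OF f']
    khom_out[OF f] khom_zero[OF f'] in simp_all)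

lemma act_shom:
  assumes B: "is_kmod G B" and g: "g \<in> carrier G"
  shows "(\<lambda>x. if x \<in> mcarrier B then maction B g x else 0) \<in> shom g B B"
proof (rule khomI)
  fix h x assume "h \<in> carrier (subgrp G M)" and x: "x \<in> mcarrier B"
  then have h: "h \<in> carrier G" using M_carrier by auto
  have "maction B (g \<otimes> h) x = maction B (g \<otimes> h \<otimes> inv g \<otimes> g) x"
    using g h by (simp add: m_assoc)
  also have "\<dots> = maction B (g \<otimes> h \<otimes> inv g) (maction B g x)"
    using g h x by (intro kmod_act_mult[OF B]) auto
  finally have "maction B g (maction B h x) = maction B (g \<otimes> h \<otimes> inv g) (maction B g x)"
    using kmod_act_mult[OF B g h x] by simp
  then show "(if maction B h x \<in> mcarrier B then maction B g (maction B h x) else 0)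
    = maction (twist G g B) h (if x \<in> mcarrier B then maction B g x else 0)"
    using x kmod_act[OF B h x] by simp
qed (auto simp: kmod_add[OF B] kmod_scale[OF B] kmod_act[OF B g] kmod_act_add[OF B g] kmod_act_scale[OF B g])

lemma shom_act:
  assumes f: "f \<in> shom g A B" and B: "is_kmod G B" and g: "g \<in> carrier G" "g' \<in> carrier G"
  shows "(\<lambda>x. maction B g' (f x)) \<in> shom (g' \<otimes> g) A B"
proof -
  have "f x \<in> mcarrier B" for x using khom_mem'[OF f, of G] B khom_mem[OF f, of x] khom_out[OF f, of x] kmod_zero[OF B]
    by (cases "x \<in> mcarrier A") auto
  then show ?thesis using shom_comp[OF f act_shom[OF B g(2)] g] by simp
qed

text \<open>The twist replaces h by a conjugate in M, and both act trivially on V, so the composite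
  is M-linear in the ordinary sense.\<close>

lemma shom_to_V:
  assumes f: "f \<in> shom g A B" and \<phi>: "\<phi> \<in> khom (subgrp G M) B V" and g: "g \<in> carrier G"
  shows "(\<lambda>x. \<phi> (f x)) \<in> khom (subgrp G M) A V"
proof (rule khomI)
  fix h x assume h: "h \<in> carrier (subgrp G M)" and x: "x \<in> mcarrier A"
  then have h': "h \<in> M" by simp
  show "\<phi> (f (maction A h x)) = maction V h (\<phi> (f x))"
    using khom_act[OF f h x] khom_act[OF \<phi>, of "g \<otimes> h \<otimes> inv g" "f x"] M_conj[OF g h'] khom_mem[OF f x]
      V_trivial khom_mem[OF \<phi>, of "f x"] h' by simp
qed (use khom_mem[OF f] khom_mem[OF \<phi>] khom_add[OF f] khom_add[OF \<phi>] khom_scale[OF f] khom_scale[OF \<phi>]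
    khom_out[OF f] khom_zero[OF \<phi>] in simp_all)

lemma act_to_V:
  assumes u: "u \<in> khom (subgrp G M) A V" and g: "g \<in> carrier G"
  shows "(\<lambda>x. maction V g (u x)) \<in> khom (subgrp G M) A V"
proof (rule khomI)
  fix h x assume h: "h \<in> carrier (subgrp G M)" and x: "x \<in> mcarrier A"
  show "maction V g (u (maction A h x)) = maction V h (maction V g (u x))"
    using khom_act[OF u h x] V_trivial[of h] khom_mem[OF u x] kmod_act[OF V g] h by simp
qed (use khom_mem[OF u] khom_add[OF u] khom_scale[OF u] khom_out[OF u] kmod_act[OF V g] kmod_act_add[OF V g]
    kmod_act_scale[OF V g] kmod_act_zero[OF V g] in simp_all)

lemma Y_kmod_M: "is_kmod (subgrp G M) (Y j)"
  by (rule is_kmod_subgrp[OF Y_kmod M_subgroup])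

lemma dY_khom_M: "dY (Suc j) \<in> khom (subgrp G M) (Y (Suc j)) (Y j)"
  by (rule khom_subgrp[OF dY_khom M_subgroup])

lemma M_group: "group (subgrp G M)"
  by (rule subgroup_imp_group[OF M_subgroup])

lemma \<gamma>: "\<gamma> [^] (i::nat) \<in> carrier G" "\<sigma> [^] (i::nat) \<in> carrier G" "\<gamma> \<in> carrier G"
  using \<sigma> by auto

lemma \<gamma>_pow: "\<gamma> [^] (i::nat) = inv (\<sigma> [^] i)"
  using \<sigma> by (simp add: nat_pow_inv)

end

section \<open>Comparison of the minimal resolution with \<open>Y\<close>\<close>

locale lhs_core = lhs_data +
  fixes P :: "nat \<Rightarrow> (_, _, 'x::ab_group_add) kmod" and dP \<epsilon>P \<theta> \<alpha> \<tau>
  assumes P_minimal: "minimal_projective_resolution (subgrp G M) P dP \<epsilon>P"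
    and \<theta>: "chain_map (subgrp G M) P dP Y dY \<theta>"
    and \<theta>_aug: "\<And>x. x \<in> mcarrier (P 0) \<Longrightarrow> \<epsilon>Y (\<theta> 0 x) = \<epsilon>P x"
    and \<alpha>: "chain_map (subgrp G M) P dP (\<lambda>k. twist G (inv \<sigma>) (P k)) dP \<alpha>"
    and \<alpha>_aug: "\<And>x. x \<in> mcarrier (P 0) \<Longrightarrow> \<epsilon>P (\<alpha> 0 x) = \<epsilon>P x"
    and \<tau>: "\<And>k. \<tau> k \<in> khom (subgrp G M) (P k) (P (Suc k))"
    and \<tau>_homotopy: "\<And>k x. x \<in> mcarrier (P k) \<Longrightarrow>
      dP (Suc k) (\<tau> k x) + \<tau> (k - 1) (dP k x) = x - (\<alpha> k ^^ q) x"
begin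

lemma P: "projective_resolution (subgrp G M) P dP \<epsilon>P"
  using P_minimal by (simp add: minimal_projective_resolution_def)

lemma P_kmod: "is_kmod (subgrp G M) (P k)" by (rule resolution_kmod[OF P])

lemma dP_khom: "dP (Suc k) \<in> khom (subgrp G M) (P (Suc k)) (P k)" by (rule resolution_diff[OF P])

lemma dP_0: "dP 0 x = 0"
  using P by (simp add: projective_resolution_def chain_complex_def)

lemma dP_mem: "x \<in> mcarrier (P k) \<Longrightarrow> dP k x \<in> mcarrier (P (k - 1))"
  using khom_mem[OF dP_khom] by (cases k) (auto simp: dP_0 kmod_zero[OF P_kmod])

lemma \<theta>_khom: "\<theta> k \<in> khom (subgrp G M) (P k) (Y k)"
  and \<theta>_chain: "x \<in> mcarrier (P (Suc k)) \<Longrightarrow> dY (Suc k) (\<theta> (Suc k) x) = \<theta> k (dP (Suc k) x)"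
  and \<alpha>_shom: "\<alpha> k \<in> shom \<gamma> (P k) (P k)"
  and \<alpha>_chain': "x \<in> mcarrier (P (Suc k)) \<Longrightarrow> dP (Suc k) (\<alpha> (Suc k) x) = \<alpha> k (dP (Suc k) x)"
  using \<theta> \<alpha> by (simp_all add: chain_map_def)

lemma \<alpha>_chain: "x \<in> mcarrier (P k) \<Longrightarrow> dP k (\<alpha> k x) = \<alpha> (k - 1) (dP k x)"
  using \<alpha>_chain' khom_zero[OF \<alpha>_shom] by (cases k) (auto simp: dP_0)

lemma \<alpha>_mem: "x \<in> mcarrier (P k) \<Longrightarrow> \<alpha> k x \<in> mcarrier (P k)"
  using khom_mem[OF \<alpha>_shom] by simp

lemma \<alpha>_pow_mem: "x \<in> mcarrier (P k) \<Longrightarrow> (\<alpha> k ^^ m) x \<in> mcarrier (P k)"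
  by (induction m) (auto simp: \<alpha>_mem)

lemma hom_trivial_boundary:
  assumes u: "u \<in> khom (subgrp G M) (P k) V" and x: "x \<in> mcarrier (P (Suc k))"
  shows "u (dP (Suc k) x) = 0"
proof (rule superfluous_hom_trivial[OF _ P_kmod V_kmod_M _ u])
  show "superfluous (subgrp G M) (P k) (res_cycles P dP \<epsilon>P k)"
    using P_minimal by (cases k) (auto simp: minimal_projective_resolution_def res_cycles_def)
  show "dP (Suc k) x \<in> res_cycles P dP \<epsilon>P k" by (rule resolution_diff_cycles[OF P x])
qed (simp add: V_trivial)

text \<open>Take c = u \<rho> with \<rho> a comparison map from Y back to P; on boundaries it is u
  of a boundary of P. Since \<rho> \<theta> is homotopic to the identity and u kills both homotopy
  terms, c \<theta> = u holds exactly and not only up to coboundary.\<close>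

lemma cocycle_through_\<theta>:
  assumes u: "u \<in> khom (subgrp G M) (P k) V"
  obtains c where "c \<in> khom (subgrp G M) (Y k) V" "\<And>y. c (dY (Suc k) y) = 0"
    "\<And>x. x \<in> mcarrier (P k) \<Longrightarrow> c (\<theta> k x) = u x"
proof -
  obtain \<rho> where \<rho>: "chain_map (subgrp G M) Y dY P dP \<rho>"
    and \<rho>_aug: "\<And>y. y \<in> mcarrier (Y 0) \<Longrightarrow> \<epsilon>P (\<rho> 0 y) = \<epsilon>Y y"
    using comparison_map[OF group_axioms M_subgroup Y P] by blast
  have \<rho>_khom: "\<rho> k \<in> khom (subgrp G M) (Y k) (P k)"
    and \<rho>_chain: "\<And>y. y \<in> mcarrier (Y (Suc k)) \<Longrightarrow> dP (Suc k) (\<rho> (Suc k) y) = \<rho> k (dY (Suc k) y)" for k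
    using \<rho> by (simp_all add: chain_map_def)
  define g where "g k = (\<lambda>x. \<rho> k (\<theta> k x) - (if x \<in> mcarrier (P k) then x else 0))" for k
  have g: "g k \<in> khom (subgrp G M) (P k) (P k)" for k
    unfolding g_def by (rule khom_minus[OF khom_comp[OF \<theta>_khom \<rho>_khom] khom_id[OF P_kmod] P_kmod])
  have base: "g 0 ` mcarrier (P 0) \<subseteq> dP (Suc 0) ` mcarrier (P (Suc 0))"
  proof -
    have "\<epsilon>P (g 0 x) = 0" if x: "x \<in> mcarrier (P 0)" for x
      using khom_diff[OF resolution_aug[OF P] P_kmod khom_mem[OF \<rho>_khom khom_mem[OF \<theta>_khom x]] x]
        \<rho>_aug[OF khom_mem[OF \<theta>_khom x]] \<theta>_aug[OF x] x by (simp add: g_def)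
    then show ?thesis
      unfolding resolution_exact[OF P] using khom_mem[OF g] by (auto simp: res_cycles_def)
  qed
  have chain: "dP (Suc k) (g (Suc k) x) = g k (dP (Suc k) x)" if x: "x \<in> mcarrier (P (Suc k))" for k x
    using khom_diff[OF dP_khom P_kmod khom_mem[OF \<rho>_khom khom_mem[OF \<theta>_khom x]] x]
      \<rho>_chain[OF khom_mem[OF \<theta>_khom x]] \<theta>_chain[OF x] x khom_mem[OF dP_khom x] by (simp add: g_def)
  have exact: "y \<in> dP (Suc (Suc k)) ` mcarrier (P (Suc (Suc k)))"
    if "y \<in> mcarrier (P (Suc k))" "dP (Suc k) y = 0" for k y
    unfolding resolution_exact[OF P] using that by (simp add: res_cycles_def)
  obtain h where h: "\<And>k. h k \<in> khom (subgrp G M) (P k) (P (Suc k))"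
    "\<And>x. x \<in> mcarrier (P 0) \<Longrightarrow> dP (Suc 0) (h 0 x) = g 0 x"
    "\<And>k x. x \<in> mcarrier (P (Suc k)) \<Longrightarrow> dP (Suc (Suc k)) (h (Suc k) x) + h k (dP (Suc k) x) = g (Suc k) x"
    by (rule null_homotopy[where E = "\<lambda>k. dP (Suc k)" and g = g and B = P,
          OF M_group P P_kmod dP_khom])
      (rule exact g base chain that; assumption)+
  have ug: "u (g k x) = 0" if x: "x \<in> mcarrier (P k)" for x
  proof (cases k)
    case 0
    then show ?thesis using h(2) hom_trivial_boundary[OF u khom_mem[OF h(1) x]] x by simp
  next
    case (Suc j)
    have x': "x \<in> mcarrier (P (Suc j))" using x Suc by simp
    have "u (g k x) = u (dP (Suc k) (h k x)) + u (h j (dP k x))"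
      using khom_add[OF u khom_mem[OF dP_khom khom_mem[OF h(1) x]], of "h j (dP k x)"]
        h(3)[OF x'] khom_mem[OF h(1) khom_mem[OF dP_khom x']] by (simp add: Suc)
    \<comment> \<open>The composite u h is again an M-homomorphism into V, so it too kills
      boundaries.\<close>
    also have "u (h j (dP k x)) = 0"
      using hom_trivial_boundary[OF khom_comp[OF h(1)], of u j x] u x' by (simp add: Suc)
    finally show ?thesis using hom_trivial_boundary[OF u khom_mem[OF h(1) x]] by simp
  qed
  show thesis
  proof (rule that[OF khom_comp[OF \<rho>_khom u]])
    show "u (\<rho> k (dY (Suc k) y)) = 0" for y
      using \<rho>_chain[of y k] hom_trivial_boundary[OF u khom_mem[OF \<rho>_khom, of y "Suc k"]]
        khom_out[OF dY_khom, of y k] khom_zero[OF \<rho>_khom] khom_zero[OF u]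
      by (cases "y \<in> mcarrier (Y (Suc k))") auto
    show "u (\<rho> k (\<theta> k x)) = u x" if x: "x \<in> mcarrier (P k)" for x
      using ug[OF x] khom_diff[OF u P_kmod khom_mem[OF \<rho>_khom khom_mem[OF \<theta>_khom x]] x] x
      by (simp add: g_def)
  qed
qed

text \<open>A \<gamma>-twisted map into Y is an M-homomorphism into the twist of Y, which has the
  same differentials and is still exact. The difference of the two lifts of the identity of K is
  therefore null-homotopic there.\<close>

lemma twisted_homotopy:
  obtains \<kappa> where "\<And>k. \<kappa> k \<in> shom \<gamma> (P k) (Y (Suc k))"
    "\<And>k x. x \<in> mcarrier (P k) \<Longrightarrow>
      \<theta> k (\<alpha> k x) - maction (Y k) \<gamma> (\<theta> k x) = dY (Suc k) (\<kappa> k x) + \<kappa> (k - 1) (dP k x)"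
proof -
  define g where "g k = (\<lambda>x. \<theta> k (\<alpha> k x) - maction (Y k) \<gamma> (\<theta> k x))" for k
  have "(\<lambda>x. \<theta> k (\<alpha> k x)) \<in> shom (\<one> \<otimes> \<gamma>) (P k) (Y k)" for k
    by (rule shom_comp[OF \<alpha>_shom]) (use \<theta>_khom \<gamma> in \<open>simp_all add: shom_one\<close>)
  moreover have "(\<lambda>x. maction (Y k) \<gamma> (\<theta> k x)) \<in> shom (\<gamma> \<otimes> \<one>) (P k) (Y k)" for k
    by (rule shom_act[OF _ Y_kmod]) (use \<theta>_khom \<gamma> in \<open>simp_all add: shom_one\<close>)
  ultimately have g: "g k \<in> shom \<gamma> (P k) (Y k)" for k
    unfolding g_def using \<gamma> by (intro khom_minus[OF _ _ is_kmod_twist[OF Y_kmod_M]]) auto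
  note Ym = khom_mem[OF \<theta>_khom]
  have base: "g 0 ` mcarrier (P 0) \<subseteq> dY (Suc 0) ` mcarrier (Y (Suc 0))"
  proof -
    \<comment> \<open>The action of \<gamma> disappears under the augmentation, as G acts trivially
      on K.\<close>
    have "\<epsilon>Y (g 0 x) = 0" if x: "x \<in> mcarrier (P 0)" for x
      using khom_diff[OF resolution_aug[OF Y] Y_kmod Ym[OF \<alpha>_mem[OF x]] kmod_act[OF Y_kmod \<gamma>(3) Ym[OF x]]]
        khom_act[OF resolution_aug[OF Y] \<gamma>(3) Ym[OF x]] \<theta>_aug[OF \<alpha>_mem[OF x]] \<alpha>_aug[OF x] \<theta>_aug[OF x]
      by (simp add: g_def trivial_kmod_def)
    then show ?thesis
      unfolding resolution_exact[OF Y] using khom_mem[OF g] by (auto simp: res_cycles_def)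
  qed
  have chain: "dY (Suc k) (g (Suc k) x) = g k (dP (Suc k) x)" if x: "x \<in> mcarrier (P (Suc k))" for k x
    using khom_diff[OF dY_khom Y_kmod Ym[OF \<alpha>_mem[OF x]] kmod_act[OF Y_kmod \<gamma>(3) Ym[OF x]]]
      khom_act[OF dY_khom \<gamma>(3) Ym[OF x]] \<theta>_chain[OF x] \<theta>_chain[OF \<alpha>_mem[OF x]] \<alpha>_chain'[OF x]
    by (simp add: g_def)
  have exact: "y \<in> dY (Suc (Suc k)) ` mcarrier (Y (Suc (Suc k)))"
    if "y \<in> mcarrier (Y (Suc k))" "dY (Suc k) y = 0" for k y
    unfolding resolution_exact[OF Y] using that by (simp add: res_cycles_def)
  obtain h where h: "\<And>k. h k \<in> shom \<gamma> (P k) (Y (Suc k))"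
    "\<And>x. x \<in> mcarrier (P 0) \<Longrightarrow> dY (Suc 0) (h 0 x) = g 0 x"
    "\<And>k x. x \<in> mcarrier (P (Suc k)) \<Longrightarrow> dY (Suc (Suc k)) (h (Suc k) x) + h k (dP (Suc k) x) = g (Suc k) x"
    by (rule null_homotopy[where E = "\<lambda>k. dY (Suc k)" and g = g and B = "\<lambda>k. twist G \<gamma> (Y k)",
          OF M_group P is_kmod_twist[OF Y_kmod_M \<gamma>(3)] khom_twist[OF dY_khom_M \<gamma>(3)],
          unfolded twist_simps]) (rule exact g base chain that; assumption)+
  show thesis
  proof (rule that[OF h(1)])
    fix k x assume x: "x \<in> mcarrier (P k)"
    show "\<theta> k (\<alpha> k x) - maction (Y k) \<gamma> (\<theta> k x) = dY (Suc k) (h k x) + h (k - 1) (dP k x)"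
      using h(2) h(3) x khom_zero[OF h(1)] by (cases k) (auto simp: g_def dP_0)
  qed
qed

end

section \<open>Telescoped homotopies and the comparison with \<tau>\<close>

locale lhs_homotopy = lhs_core +
  fixes \<kappa>
  assumes \<kappa>_shom: "\<And>k. \<kappa> k \<in> shom \<gamma> (P k) (Y (Suc k))"
    and \<kappa>_homotopy: "\<And>k x. x \<in> mcarrier (P k) \<Longrightarrow>
      \<theta> k (\<alpha> k x) - maction (Y k) \<gamma> (\<theta> k x) = dY (Suc k) (\<kappa> k x) + \<kappa> (k - 1) (dP k x)"
begin

primrec K where
  "K 0 k x = 0"
| "K (Suc m) k x = K m k (\<alpha> k x) + maction (Y (Suc k)) (\<gamma> [^] m) (\<kappa> k x)"

lemma K_shom: "K m k \<in> shom (\<gamma> [^] m) (P k) (Y (Suc k))"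
proof (induction m)
  case 0
  have "K 0 k = (\<lambda>x. 0)" by (simp add: fun_eq_iff)
  then show ?case using khom_null[OF is_kmod_twist[OF Y_kmod_M \<gamma>(1)[of 0]]] by simp
next
  case (Suc m)
  have "K (Suc m) k = (\<lambda>x. K m k (\<alpha> k x) + maction (Y (Suc k)) (\<gamma> [^] m) (\<kappa> k x))"
    by (simp add: fun_eq_iff)
  then show ?case
    using khom_plus[OF shom_comp[OF \<alpha>_shom Suc \<gamma>(3,1)] shom_act[OF \<kappa>_shom Y_kmod \<gamma>(3,1)]
        is_kmod_twist[OF Y_kmod_M]] \<gamma>(1)[of "Suc m"] by simp
qed

lemma \<theta>_mem: "x \<in> mcarrier (P k) \<Longrightarrow> \<theta> k x \<in> mcarrier (Y k)"
  by (rule khom_mem[OF \<theta>_khom])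

lemma \<kappa>_mem: "x \<in> mcarrier (P k) \<Longrightarrow> \<kappa> k x \<in> mcarrier (Y (Suc k))"
  using khom_mem[OF \<kappa>_shom] by simp

lemma K_mem: "x \<in> mcarrier (P k) \<Longrightarrow> K m k x \<in> mcarrier (Y (Suc k))"
  using khom_mem[OF K_shom] by simp

lemma \<kappa>_bd_mem:
  assumes "x \<in> mcarrier (P k)" shows "\<kappa> (k - 1) (dP k x) \<in> mcarrier (Y k)"
  using \<kappa>_mem[OF dP_mem[OF assms]] khom_zero[OF \<kappa>_shom] kmod_zero[OF Y_kmod]
  by (cases k) (auto simp: dP_0)

text \<open>The relation for \<kappa>, solved for \<gamma> \<theta> and acted on by \<gamma>^m, with
  the action pulled through the G-linear \<open>dY\<close>. It drives both \<open>K_homotopy\<close>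
  and the evaluation of b in \<open>b_\<theta>_\<gamma>\<close>.\<close>

lemma \<theta>_\<gamma>:
  assumes x: "x \<in> mcarrier (P k)"
  shows "maction (Y k) (\<gamma> [^] Suc m) (\<theta> k x) = maction (Y k) (\<gamma> [^] m) (\<theta> k (\<alpha> k x))
    - dY (Suc k) (maction (Y (Suc k)) (\<gamma> [^] m) (\<kappa> k x)) - maction (Y k) (\<gamma> [^] m) (\<kappa> (k - 1) (dP k x))"
proof -
  note act_diff = kmod_act_diff[OF Y_kmod \<gamma>(1)]
  have d\<kappa>: "dY (Suc k) (\<kappa> k x) \<in> mcarrier (Y k)" by (rule khom_mem[OF dY_khom \<kappa>_mem[OF x]])
  have \<theta>\<alpha>: "\<theta> k (\<alpha> k x) \<in> mcarrier (Y k)" by (rule \<theta>_mem[OF \<alpha>_mem[OF x]])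
  have "maction (Y k) \<gamma> (\<theta> k x) = \<theta> k (\<alpha> k x) - dY (Suc k) (\<kappa> k x) - \<kappa> (k - 1) (dP k x)"
    using \<kappa>_homotopy[OF x] by (simp add: algebra_simps)
  then have "maction (Y k) (\<gamma> [^] Suc m) (\<theta> k x)
      = maction (Y k) (\<gamma> [^] m) (\<theta> k (\<alpha> k x) - dY (Suc k) (\<kappa> k x) - \<kappa> (k - 1) (dP k x))"
    using kmod_act_mult[OF Y_kmod \<gamma>(1,3) \<theta>_mem[OF x], of m] by simp
  also have "\<dots> = maction (Y k) (\<gamma> [^] m) (\<theta> k (\<alpha> k x)) - maction (Y k) (\<gamma> [^] m) (dY (Suc k) (\<kappa> k x))
      - maction (Y k) (\<gamma> [^] m) (\<kappa> (k - 1) (dP k x))"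
    by (simp only: act_diff[OF kmod_diff[OF Y_kmod \<theta>\<alpha> d\<kappa>] \<kappa>_bd_mem[OF x]] act_diff[OF \<theta>\<alpha> d\<kappa>])
  finally show ?thesis using khom_act[OF dY_khom \<gamma>(1) \<kappa>_mem[OF x]] by simp
qed

lemma K_homotopy:
  "x \<in> mcarrier (P k) \<Longrightarrow>
    \<theta> k ((\<alpha> k ^^ m) x) - maction (Y k) (\<gamma> [^] m) (\<theta> k x) = dY (Suc k) (K m k x) + K m (k - 1) (dP k x)"
proof (induction m arbitrary: x)
  case 0
  then show ?case using kmod_act_one[OF Y_kmod \<theta>_mem[OF 0]] khom_zero[OF dY_khom] by simp
next
  case (Suc m)
  note x = Suc.prems
  let ?g = "maction (Y (Suc k)) (\<gamma> [^] m) (\<kappa> k x)"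
  have "dY (Suc k) (K (Suc m) k x) = dY (Suc k) (K m k (\<alpha> k x)) + dY (Suc k) ?g"
    using khom_add[OF dY_khom K_mem[OF \<alpha>_mem[OF x]] kmod_act[OF Y_kmod \<gamma>(1) \<kappa>_mem[OF x]]] by simp
  \<comment> \<open>For k = 0 the index \<open>Suc (k - 1)\<close> is 1 and not k, but then both
    actions are applied to 0.\<close>
  moreover have "maction (Y (Suc (k - 1))) (\<gamma> [^] m) (\<kappa> (k - 1) (dP k x)) = maction (Y k) (\<gamma> [^] m) (\<kappa> (k - 1) (dP k x))"
    using khom_zero[OF \<kappa>_shom] kmod_act_zero[OF Y_kmod \<gamma>(1)] by (cases k) (auto simp: dP_0)
  ultimately show ?case
    using Suc.IH[OF \<alpha>_mem[OF x]] \<theta>_\<gamma>[OF x, of m] \<alpha>_chain[OF x]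
    by (simp add: funpow_swap1 algebra_simps del: nat_pow_Suc)
qed

text \<open>As \<gamma>^q = 1, \<open>K q\<close> is a homotopy with boundary \<theta> \<alpha>^q -
  \<theta>, while \<theta> \<tau> has boundary \<theta> - \<theta> \<alpha>^q. The boundary of the
  sum is 0.\<close>

definition \<psi> where "\<psi> k x = \<theta> (Suc k) (\<tau> k x) + K q k x"

lemma \<gamma>_card: "\<gamma> [^] q = \<one>"
  using \<sigma>_pow_card by (simp add: \<gamma>_pow)

lemma \<psi>_khom: "\<psi> k \<in> khom (subgrp G M) (P k) (Y (Suc k))"
proof -
  have "K q k \<in> khom (subgrp G M) (P k) (Y (Suc k))" using K_shom[of q k] by (simp add: \<gamma>_card shom_one)
  from khom_plus[OF khom_comp[OF \<tau> \<theta>_khom] this Y_kmod_M] show ?thesis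
    by (simp add: \<psi>_def[abs_def])
qed

lemma \<tau>_mem: "x \<in> mcarrier (P k) \<Longrightarrow> \<tau> k x \<in> mcarrier (P (Suc k))"
  by (rule khom_mem[OF \<tau>])

lemma \<psi>_chain:
  assumes x: "x \<in> mcarrier (P k)"
  shows "dY (Suc k) (\<psi> k x) + \<psi> (k - 1) (dP k x) = 0"
proof -
  have 1: "dY (Suc k) (\<psi> k x) = \<theta> k (dP (Suc k) (\<tau> k x)) + dY (Suc k) (K q k x)"
    unfolding \<psi>_def using khom_add[OF dY_khom \<theta>_mem[OF \<tau>_mem[OF x]] K_mem[OF x]] \<theta>_chain[OF \<tau>_mem[OF x]] by simp
  have 2: "\<psi> (k - 1) (dP k x) = \<theta> k (\<tau> (k - 1) (dP k x)) + K q (k - 1) (dP k x)"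
    using khom_zero[OF \<tau>] khom_zero[OF \<theta>_khom] by (cases k) (auto simp: \<psi>_def dP_0)
  have \<tau>d: "\<tau> (k - 1) (dP k x) \<in> mcarrier (P k)"
    using \<tau>_mem[OF dP_mem[OF x]] khom_zero[OF \<tau>] kmod_zero[OF P_kmod] by (cases k) (auto simp: dP_0)
  have "\<theta> k (dP (Suc k) (\<tau> k x)) + \<theta> k (\<tau> (k - 1) (dP k x)) = \<theta> k (x - (\<alpha> k ^^ q) x)"
    using khom_add[OF \<theta>_khom khom_mem[OF dP_khom \<tau>_mem[OF x]] \<tau>d] \<tau>_homotopy[OF x] by simp
  also have "\<dots> = \<theta> k x - \<theta> k ((\<alpha> k ^^ q) x)"
    by (rule khom_diff[OF \<theta>_khom P_kmod x \<alpha>_pow_mem[OF x]])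
  finally show ?thesis
    unfolding 1 2 using K_homotopy[OF x, of q] kmod_act_one[OF Y_kmod \<theta>_mem[OF x]]
    by (simp add: \<gamma>_card algebra_simps)
qed

text \<open>Since \<psi> anticommutes with the differentials, it is a chain map into Y shifted by
  one with differential -d, so that \<psi> = -d \<eta> + \<eta> d for some \<eta>. The cocycle a
  kills the first term, and minimality kills the second because a \<eta> maps into V.\<close>

lemma cocycle_\<tau>:
  assumes a: "a \<in> khom (subgrp G M) (Y (Suc k)) V" and coc: "\<And>y. a (dY (Suc (Suc k)) y) = 0"
    and x: "x \<in> mcarrier (P k)"
  shows "a (\<theta> (Suc k) (\<tau> k x)) = - a (K q k x)"
proof -
  have E: "(\<lambda>y. 0 - dY (Suc (Suc k)) y) \<in> khom (subgrp G M) (Y (Suc (Suc k))) (Y (Suc k))" for k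
    by (rule khom_minus[OF khom_null[OF Y_kmod_M] dY_khom_M Y_kmod_M])
  have exact: "y \<in> (\<lambda>y. 0 - dY (Suc (Suc k)) y) ` mcarrier (Y (Suc (Suc k)))"
    if "y \<in> mcarrier (Y (Suc k))" "dY (Suc k) y = 0" for k y
  proof -
    have "y \<in> dY (Suc (Suc k)) ` mcarrier (Y (Suc (Suc k)))"
      unfolding resolution_exact[OF Y] using that by (simp add: res_cycles_def)
    then obtain z where z: "z \<in> mcarrier (Y (Suc (Suc k)))" "y = dY (Suc (Suc k)) z" by blast
    then have "y = 0 - dY (Suc (Suc k)) (- z)"
      using khom_diff[OF dY_khom Y_kmod kmod_zero[OF Y_kmod] z(1)] khom_zero[OF dY_khom] by simp
    then show ?thesis using kmod_uminus[OF Y_kmod z(1)] by blast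
  qed
  \<comment> \<open>The shifted complex starts at Y_1, so exactness of Y at Y_1 takes the place of
    an augmentation condition.\<close>
  have base: "\<psi> 0 ` mcarrier (P 0) \<subseteq> (\<lambda>y. 0 - dY (Suc (Suc 0)) y) ` mcarrier (Y (Suc (Suc 0)))"
  proof (clarify)
    fix x assume x: "x \<in> mcarrier (P 0)"
    have "dY (Suc 0) (\<psi> 0 x) = 0"
      using \<psi>_chain[OF x] khom_zero[OF \<psi>_khom] by (simp add: dP_0)
    then show "\<psi> 0 x \<in> (\<lambda>y. 0 - dY (Suc (Suc 0)) y) ` mcarrier (Y (Suc (Suc 0)))"
      using exact khom_mem[OF \<psi>_khom x] by blast
  qed
  have chain: "0 - dY (Suc (Suc k)) (\<psi> (Suc k) x) = \<psi> k (dP (Suc k) x)" if "x \<in> mcarrier (P (Suc k))" for k x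
    using \<psi>_chain[OF that] by (simp add: minus_equation_iff add_eq_0_iff)
  have exact': "y \<in> (\<lambda>y. 0 - dY (Suc (Suc (Suc k))) y) ` mcarrier (Y (Suc (Suc (Suc k))))"
    if "y \<in> mcarrier (Y (Suc (Suc k)))" "0 - dY (Suc (Suc k)) y = 0" for k y
    using exact[OF that(1)] that(2) by simp
  obtain \<eta> where \<eta>: "\<And>k. \<eta> k \<in> khom (subgrp G M) (P k) (Y (Suc (Suc k)))"
    "\<And>x. x \<in> mcarrier (P 0) \<Longrightarrow> 0 - dY (Suc (Suc 0)) (\<eta> 0 x) = \<psi> 0 x"
    "\<And>k x. x \<in> mcarrier (P (Suc k)) \<Longrightarrow>
      0 - dY (Suc (Suc (Suc k))) (\<eta> (Suc k) x) + \<eta> k (dP (Suc k) x) = \<psi> (Suc k) x"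
    by (rule null_homotopy[where B = "\<lambda>k. Y (Suc k)" and E = "\<lambda>k y. 0 - dY (Suc (Suc k)) y" and g = \<psi>,
          OF M_group P Y_kmod_M E]) (rule exact' \<psi>_khom base chain that; assumption)+
  have "a (0 - dY (Suc (Suc k)) (\<eta> k x)) = 0"
    using khom_diff[OF a Y_kmod kmod_zero[OF Y_kmod] khom_mem[OF dY_khom khom_mem[OF \<eta>(1) x]]]
      khom_zero[OF a] coc by simp
  moreover have "a (\<eta> j (dP (Suc j) x)) = 0" if j: "k = Suc j" for j
    using hom_trivial_boundary[OF khom_comp[OF \<eta>(1)], of a j x] a x j by simp
  ultimately have "a (\<psi> k x) = 0"
    using \<eta>(2) \<eta>(3) x khom_add[OF a khom_mem[OF E khom_mem[OF \<eta>(1) x]], of "\<eta> (k - 1) (dP k x)"]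
      khom_mem[OF \<eta>(1) dP_mem[OF x]]
    by (cases k) auto
  then show ?thesis
    using khom_add[OF a \<theta>_mem[OF \<tau>_mem[OF x]] K_mem[OF x]] by (simp add: \<psi>_def add_eq_0_iff2)
qed

section \<open>Correcting the component in column r + 1\<close>

context
  fixes a k
  assumes a: "a \<in> khom (subgrp G M) (Y (Suc k)) V" and coc: "\<And>y. a (dY (Suc (Suc k)) y) = 0"
begin

definition R where "R m x = maction V (\<sigma> [^] m) (a (K m k x))"
text \<open>With T the conjugation action of \<sigma>, this is \<sigma> (T^m a) \<kappa>.\<close>

definition W where "W m x = maction V (\<sigma> [^] Suc m) (a (maction (Y (Suc k)) (\<gamma> [^] m) (\<kappa> k x)))"

lemma R_khom: "R m \<in> khom (subgrp G M) (P k) V"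
  unfolding R_def[abs_def] by (rule act_to_V[OF shom_to_V[OF K_shom a \<gamma>(1)] \<gamma>(2)])

lemma W_khom: "W m \<in> khom (subgrp G M) (P k) V"
  unfolding W_def[abs_def]
  by (rule act_to_V[OF shom_to_V[OF shom_act[OF \<kappa>_shom Y_kmod \<gamma>(3,1)] a] \<gamma>(2)]) (simp add: \<gamma>)

lemma R_0: "R 0 x = 0"
  using khom_zero[OF a] kmod_act_zero[OF V] by (simp add: R_def)

lemma \<sigma>_Suc: "v \<in> mcarrier V \<Longrightarrow> maction V (\<sigma> [^] Suc m) v = maction V \<sigma> (maction V (\<sigma> [^] m) v)"
  using kmod_act_mult[OF V \<sigma> \<gamma>(2)] \<sigma> nat_pow_Suc2[OF \<sigma>, of m] by simp

lemma R_Suc: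
  assumes x: "x \<in> mcarrier (P k)"
  shows "R (Suc m) x = maction V \<sigma> (R m (\<alpha> k x)) + W m x"
proof -
  have g: "maction (Y (Suc k)) (\<gamma> [^] m) (\<kappa> k x) \<in> mcarrier (Y (Suc k))"
    by (rule kmod_act[OF Y_kmod \<gamma>(1) \<kappa>_mem[OF x]])
  note K\<alpha> = K_mem[OF \<alpha>_mem[OF x], of m]
  have "R (Suc m) x = maction V (\<sigma> [^] Suc m) (a (K m k (\<alpha> k x)))
      + maction V (\<sigma> [^] Suc m) (a (maction (Y (Suc k)) (\<gamma> [^] m) (\<kappa> k x)))"
    using khom_add[OF a K\<alpha> g] kmod_act_add[OF V \<gamma>(2)[of "Suc m"] khom_mem[OF a K\<alpha>] khom_mem[OF a g]]
    by (simp add: R_def del: nat_pow_Suc)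
  then show ?thesis
    using \<sigma>_Suc[OF khom_mem[OF a K\<alpha>], of m] by (simp add: R_def W_def del: nat_pow_Suc)
qed

lemma R_card:
  assumes x: "x \<in> mcarrier (P k)" shows "R q x = - a (\<theta> (Suc k) (\<tau> k x))"
  using cocycle_\<tau>[OF a coc x] kmod_act_one[OF V khom_mem[OF a K_mem[OF x]]]
  by (simp add: R_def \<sigma>_pow_card)

text \<open>The last term of \<open>\<theta>_\<gamma>\<close> drops out: z maps to b (\<gamma>^m
  \<kappa> z) by an M-homomorphism into V, which vanishes on boundaries.\<close>

lemma b_\<theta>_\<gamma>:
  assumes b: "b \<in> khom (subgrp G M) (Y k) V" and x: "x \<in> mcarrier (P k)"
  shows "b (maction (Y k) (\<gamma> [^] Suc m) (\<theta> k x)) = b (maction (Y k) (\<gamma> [^] m) (\<theta> k (\<alpha> k x)))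
    - b (dY (Suc k) (maction (Y (Suc k)) (\<gamma> [^] m) (\<kappa> k x)))"
proof -
  have m: "maction (Y k) (\<gamma> [^] m) (\<theta> k (\<alpha> k x)) \<in> mcarrier (Y k)"
    "dY (Suc k) (maction (Y (Suc k)) (\<gamma> [^] m) (\<kappa> k x)) \<in> mcarrier (Y k)"
    "maction (Y k) (\<gamma> [^] m) (\<kappa> (k - 1) (dP k x)) \<in> mcarrier (Y k)"
    using kmod_act[OF Y_kmod \<gamma>(1)] \<theta>_mem[OF \<alpha>_mem[OF x]] khom_mem[OF dY_khom] \<kappa>_mem[OF x] \<kappa>_bd_mem[OF x]
    by blast+
  have "b (maction (Y k) (\<gamma> [^] m) (\<kappa> (k - 1) (dP k x))) = 0"
  proof (cases k)
    case 0
    then show ?thesis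
      using khom_zero[OF \<kappa>_shom] kmod_act_zero[OF Y_kmod \<gamma>(1)] khom_zero[OF b] by (simp add: dP_0)
  next
    case (Suc j)
    have "(\<lambda>z. b (maction (Y (Suc j)) (\<gamma> [^] m) (\<kappa> j z))) \<in> khom (subgrp G M) (P j) V"
      by (rule shom_to_V[OF shom_act[OF \<kappa>_shom Y_kmod \<gamma>(3,1)]]) (use b Suc \<gamma> in auto)
    from hom_trivial_boundary[OF this, of x] x Suc show ?thesis by simp
  qed
  then show ?thesis
    unfolding \<theta>_\<gamma>[OF x]
    using khom_diff[OF b Y_kmod kmod_diff[OF Y_kmod m(1,2)] m(3)] khom_diff[OF b Y_kmod m(1,2)] by simp
qed

text \<open>The telescoping identity (T^i b') \<theta> = R_i - R_{i+1} dictates c: for i = 0 it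
  demands b' \<theta> = -W_0, which a cocycle correction can achieve. The later cases follow by
  induction from b' d = (T - 1) a, a relation that subtracting a cocycle preserves.\<close>

lemma correction_even:
  assumes b: "b \<in> khom (subgrp G M) (Y k) V"
    and db: "\<And>y. y \<in> mcarrier (Y (Suc k)) \<Longrightarrow>
      b (dY (Suc k) y) = maction V \<sigma> (a (maction (Y (Suc k)) \<gamma> y)) - a y"
  obtains c where "c \<in> khom (subgrp G M) (Y k) V" "\<And>y. c (dY (Suc k) y) = 0"
    "\<And>x. x \<in> mcarrier (P k) \<Longrightarrow>
      (\<Sum>i<q. maction V (\<sigma> [^] i) ((b - c) (maction (Y k) (\<gamma> [^] i) (\<theta> k x)))) = a (\<theta> (Suc k) (\<tau> k x))"
proof -
  obtain c where c: "c \<in> khom (subgrp G M) (Y k) V" and dc: "\<And>y. c (dY (Suc k) y) = 0"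
    and c\<theta>: "\<And>x. x \<in> mcarrier (P k) \<Longrightarrow> c (\<theta> k x) = b (\<theta> k x) + W 0 x"
    using cocycle_through_\<theta>[OF khom_plus[OF khom_comp[OF \<theta>_khom b] W_khom V_kmod_M]] by blast
  define b' where "b' = b - c"
  have b': "b' \<in> khom (subgrp G M) (Y k) V"
    using khom_minus[OF b c V_kmod_M] by (simp add: b'_def fun_diff_def)
  note Rm = khom_mem[OF R_khom] and am = khom_mem[OF a]
  have tele: "maction V (\<sigma> [^] i) (b' (maction (Y k) (\<gamma> [^] i) (\<theta> k x))) = R i x - R (Suc i) x"
    if "x \<in> mcarrier (P k)" for i x
    using that
  proof (induction i arbitrary: x)
    case 0
    have "b' (\<theta> k x) = - W 0 x" using c\<theta>[OF 0] by (simp add: b'_def)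
    moreover have "R (Suc 0) x = W 0 x"
      using R_Suc[OF 0, of 0] R_0 kmod_act_zero[OF V \<sigma>] by simp
    moreover have "b' (\<theta> k x) \<in> mcarrier V" by (rule khom_mem[OF b' \<theta>_mem[OF 0]])
    ultimately show ?case
      using kmod_act_one[OF Y_kmod \<theta>_mem[OF 0]] kmod_act_one[OF V] R_0 by simp
  next
    case (Suc i)
    note x = Suc.prems
    define z where "z = maction (Y (Suc k)) (\<gamma> [^] i) (\<kappa> k x)"
    have z: "z \<in> mcarrier (Y (Suc k))" unfolding z_def by (rule kmod_act[OF Y_kmod \<gamma>(1) \<kappa>_mem[OF x]])
    have \<gamma>z: "maction (Y (Suc k)) \<gamma> z = maction (Y (Suc k)) (\<gamma> [^] Suc i) (\<kappa> k x)"
      unfolding z_def nat_pow_Suc2[OF \<gamma>(3)] by (rule kmod_act_mult[OF Y_kmod \<gamma>(3,1) \<kappa>_mem[OF x], symmetric])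
    have \<gamma>zm: "maction (Y (Suc k)) \<gamma> z \<in> mcarrier (Y (Suc k))" by (rule kmod_act[OF Y_kmod \<gamma>(3) z])
    let ?u = "b' (maction (Y k) (\<gamma> [^] i) (\<theta> k (\<alpha> k x)))"
    have u: "?u \<in> mcarrier V" using khom_mem[OF b' kmod_act[OF Y_kmod \<gamma>(1) \<theta>_mem[OF \<alpha>_mem[OF x]]]] .
    have dz: "b' (dY (Suc k) z) = maction V \<sigma> (a (maction (Y (Suc k)) \<gamma> z)) - a z"
      using db[OF z] dc by (simp add: b'_def)
    have \<sigma>a: "maction V \<sigma> (a (maction (Y (Suc k)) \<gamma> z)) \<in> mcarrier V"
      by (rule kmod_act[OF V \<sigma> am[OF \<gamma>zm]])
    have "maction V (\<sigma> [^] Suc i) (b' (maction (Y k) (\<gamma> [^] Suc i) (\<theta> k x)))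
        = maction V (\<sigma> [^] Suc i) ?u - maction V (\<sigma> [^] Suc i) (b' (dY (Suc k) z))"
      unfolding b_\<theta>_\<gamma>[OF b' x] z_def[symmetric]
      by (rule kmod_act_diff[OF V \<gamma>(2) u khom_mem[OF b' khom_mem[OF dY_khom z]]])
    also have "maction V (\<sigma> [^] Suc i) ?u = maction V \<sigma> (R i (\<alpha> k x)) - maction V \<sigma> (R (Suc i) (\<alpha> k x))"
      using \<sigma>_Suc[OF u, of i] Suc.IH[OF \<alpha>_mem[OF x]]
        kmod_act_diff[OF V \<sigma> Rm[OF \<alpha>_mem[OF x]] Rm[OF \<alpha>_mem[OF x]]] by simp
    \<comment> \<open>The two halves of (T - 1) a become consecutive terms W, which turn the
      recursion of R at i and at i + 1 into the required difference.\<close>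
    also have "maction V (\<sigma> [^] Suc i) (b' (dY (Suc k) z)) = W (Suc i) x - W i x"
    proof -
      have "maction V (\<sigma> [^] Suc i) (maction V \<sigma> (a (maction (Y (Suc k)) \<gamma> z))) = W (Suc i) x"
        unfolding W_def \<gamma>z[symmetric]
        using kmod_act_mult[OF V \<gamma>(2)[of "Suc i"] \<sigma> am[OF \<gamma>zm]] by simp
      then show ?thesis
        unfolding dz kmod_act_diff[OF V \<gamma>(2) \<sigma>a am[OF z]] by (simp add: W_def z_def)
    qed
    finally show ?case using R_Suc[OF x, of i] R_Suc[OF x, of "Suc i"]
      by (simp add: algebra_simps del: nat_pow_Suc K.simps)
  qed
  show thesis
  proof (rule that[OF c dc])
    fix x assume x: "x \<in> mcarrier (P k)"
    have "(\<Sum>i<q. maction V (\<sigma> [^] i) (b' (maction (Y k) (\<gamma> [^] i) (\<theta> k x)))) = (\<Sum>i<q. R i x - R (Suc i) x)"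
      using tele[OF x] by simp
    also have "\<dots> = - R q x" using sum_lessThan_telescope'[of "\<lambda>i. R i x" q] by (simp add: R_0)
    finally show "(\<Sum>i<q. maction V (\<sigma> [^] i) ((b - c) (maction (Y k) (\<gamma> [^] i) (\<theta> k x)))) = a (\<theta> (Suc k) (\<tau> k x))"
      using R_card[OF x] by (simp add: b'_def)
  qed
qed

text \<open>Because b' d = - N a, passing from b' \<theta> to (T b') \<theta> applies \<sigma> and
  \<alpha> and adds the sum of the W_i. If b' \<theta> is the sum of the R_i, every summand thereby
  moves to R_{i+1}, and T - 1 leaves R_q - R_0.\<close>

lemma correction_odd:
  assumes b: "b \<in> khom (subgrp G M) (Y k) V"
    and db: "\<And>y. y \<in> mcarrier (Y (Suc k)) \<Longrightarrow>
      b (dY (Suc k) y) = - (\<Sum>i<q. maction V (\<sigma> [^] i) (a (maction (Y (Suc k)) (\<gamma> [^] i) y)))"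
  obtains c where "c \<in> khom (subgrp G M) (Y k) V" "\<And>y. c (dY (Suc k) y) = 0"
    "\<And>x. x \<in> mcarrier (P k) \<Longrightarrow>
      maction V \<sigma> ((b - c) (maction (Y k) \<gamma> (\<theta> k x))) - (b - c) (\<theta> k x) = - a (\<theta> (Suc k) (\<tau> k x))"
proof -
  have "(\<lambda>x. \<Sum>i<q. R i x) \<in> khom (subgrp G M) (P k) V"
    by (rule khom_setsum[OF R_khom V_kmod_M])
  from cocycle_through_\<theta>[OF khom_minus[OF khom_comp[OF \<theta>_khom b] this V_kmod_M]]
  obtain c where c: "c \<in> khom (subgrp G M) (Y k) V" and dc: "\<And>y. c (dY (Suc k) y) = 0"
    and c\<theta>: "\<And>x. x \<in> mcarrier (P k) \<Longrightarrow> c (\<theta> k x) = b (\<theta> k x) - (\<Sum>i<q. R i x)"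
    by metis
  define b' where "b' = b - c"
  have b': "b' \<in> khom (subgrp G M) (Y k) V"
    using khom_minus[OF b c V_kmod_M] by (simp add: b'_def fun_diff_def)
  have b'\<theta>: "b' (\<theta> k x) = (\<Sum>i<q. R i x)" if "x \<in> mcarrier (P k)" for x
    using c\<theta>[OF that] by (simp add: b'_def)
  note Rm = khom_mem[OF R_khom] and am = khom_mem[OF a]
  show thesis
  proof (rule that[OF c dc])
    fix x assume x: "x \<in> mcarrier (P k)"
    note \<alpha>x = \<alpha>_mem[OF x]
    have gm: "a (maction (Y (Suc k)) (\<gamma> [^] i) (\<kappa> k x)) \<in> mcarrier V" for i :: nat
      by (rule am[OF kmod_act[OF Y_kmod \<gamma>(1) \<kappa>_mem[OF x]]])
    \<comment> \<open>This is (N a) \<kappa>, the contribution of the homotopy term; one more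
      \<sigma> makes it the sum of the W_i.\<close>
    let ?w = "\<Sum>i<q. maction V (\<sigma> [^] i) (a (maction (Y (Suc k)) (\<gamma> [^] i) (\<kappa> k x)))"
    have \<sigma>g: "maction V (\<sigma> [^] i) (a (maction (Y (Suc k)) (\<gamma> [^] i) (\<kappa> k x))) \<in> mcarrier V" for i :: nat
      by (rule kmod_act[OF V \<gamma>(2) gm])
    have w: "?w \<in> mcarrier V" by (rule kmod_sum[OF V \<sigma>g])
    have \<sigma>w: "maction V \<sigma> ?w = (\<Sum>i<q. W i x)"
      using kmod_act_sum[OF V \<sigma> \<sigma>g] \<sigma>_Suc[OF gm] by (simp add: W_def del: nat_pow_Suc)
    have "b' (maction (Y k) \<gamma> (\<theta> k x)) = (\<Sum>i<q. R i (\<alpha> k x)) - b (dY (Suc k) (\<kappa> k x))"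
      using b_\<theta>_\<gamma>[OF b' x, of 0] kmod_act_one[OF Y_kmod \<theta>_mem[OF \<alpha>x]] kmod_act_one[OF Y_kmod \<kappa>_mem[OF x]]
        b'\<theta>[OF \<alpha>x] dc \<gamma>(3) by (simp add: b'_def)
    also have "\<dots> = (\<Sum>i<q. R i (\<alpha> k x)) + ?w" using db[OF \<kappa>_mem[OF x]] by simp
    finally have "maction V \<sigma> (b' (maction (Y k) \<gamma> (\<theta> k x)))
        = maction V \<sigma> (\<Sum>i<q. R i (\<alpha> k x)) + (\<Sum>i<q. W i x)"
      using kmod_act_add[OF V \<sigma> kmod_sum[OF V Rm[OF \<alpha>x]] w] \<sigma>w by simp
    also have "\<dots> = (\<Sum>i<q. R (Suc i) x)"
      using kmod_act_sum[OF V \<sigma> Rm[OF \<alpha>x]] R_Suc[OF x] by (simp add: sum.distrib)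
    finally have "maction V \<sigma> (b' (maction (Y k) \<gamma> (\<theta> k x))) - b' (\<theta> k x) = (\<Sum>i<q. R (Suc i) x - R i x)"
      using b'\<theta>[OF x] by (simp add: sum_subtractf)
    also have "\<dots> = R q x" using sum_lessThan_telescope[of "\<lambda>i. R i x" q] by (simp add: R_0)
    finally show "maction V \<sigma> ((b - c) (maction (Y k) \<gamma> (\<theta> k x))) - (b - c) (\<theta> k x) = - a (\<theta> (Suc k) (\<tau> k x))"
      using R_card[OF x] by (simp add: b'_def)
  qed
qed

end

end

section \<open>Evaluation of d_2 on a class\<close>

context lhs_core begin

text \<open>Joins the two parities in the form in which column r + 1 of the total differential
  delivers its condition. The homotopy \<kappa> is chosen inside, so the result depends only on
  \<alpha>, \<tau> and \<theta>.\<close>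

lemma correction:
  assumes "a \<in> khom (subgrp G M) (Y (Suc k)) V" "\<And>y. a (dY (Suc (Suc k)) y) = 0"
    and "b \<in> khom (subgrp G M) (Y k) V"
    and "\<And>y. y \<in> mcarrier (Y (Suc k)) \<Longrightarrow> (if even r
      then maction V \<sigma> (a (maction (Y (Suc k)) \<gamma> y)) - a y - b (dY (Suc k) y) = 0
      else (\<Sum>i<q. maction V (\<sigma> [^] i) (a (maction (Y (Suc k)) (\<gamma> [^] i) y))) + b (dY (Suc k) y) = 0)"
  obtains c where "c \<in> khom (subgrp G M) (Y k) V" "\<And>y. c (dY (Suc k) y) = 0"
    "\<And>x. x \<in> mcarrier (P k) \<Longrightarrow> (if even r
      then \<Sum>i<q. maction V (\<sigma> [^] i) ((b - c) (maction (Y k) (\<gamma> [^] i) (\<theta> k x)))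
      else maction V \<sigma> ((b - c) (maction (Y k) \<gamma> (\<theta> k x))) - (b - c) (\<theta> k x))
      = mscale V ((-1) ^ r) (a (\<theta> (Suc k) (\<tau> k x)))"
proof -
  obtain \<kappa> where \<kappa>: "\<And>k. \<kappa> k \<in> shom \<gamma> (P k) (Y (Suc k))"
    "\<And>k x. x \<in> mcarrier (P k) \<Longrightarrow>
      \<theta> k (\<alpha> k x) - maction (Y k) \<gamma> (\<theta> k x) = dY (Suc k) (\<kappa> k x) + \<kappa> (k - 1) (dP k x)"
    using twisted_homotopy by blast
  interpret lhs_homotopy G M \<sigma> V Y dY \<epsilon>Y P dP \<epsilon>P \<theta> \<alpha> \<tau> \<kappa>
    by unfold_locales (fact \<kappa>)+
  show thesis
  proof (cases "even r")
    case True
    have "b (dY (Suc k) y) = maction V \<sigma> (a (maction (Y (Suc k)) \<gamma> y)) - a y"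
      if "y \<in> mcarrier (Y (Suc k))" for y
      using assms(4)[OF that] True by simp
    from correction_even[OF assms(1-3) this] show thesis
      using that True by (simp add: kmod_scale_one[OF V]) blast
  next
    case False
    have "b (dY (Suc k) y) = - (\<Sum>i<q. maction V (\<sigma> [^] i) (a (maction (Y (Suc k)) (\<gamma> [^] i) y)))"
      if "y \<in> mcarrier (Y (Suc k))" for y
      using assms(4)[OF that] False by (simp add: eq_neg_iff_add_eq_0 add.commute)
    from correction_odd[OF assms(1-3) this] show thesis
      using that False by (simp add: kmod_scale_one[OF V] kmod_scale_left_minus[OF V]) blast
  qed
qed

text \<open>The first two columns of d x have to vanish, which yields exactly the hypotheses of
  \<open>correction\<close>. After the representative has been corrected, column r + 2 of its
  differential restricts along \<theta> to the claimed cochain.\<close>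

lemma d2_represented:
  assumes s: "s \<ge> 1" and \<zeta>: "\<zeta> \<in> ss_page FF dd 2 (int r) (int s)"
    and rep: "represented_by G M P V \<theta> r s \<zeta> f"
  shows "represented_by G M P V \<theta> (r + 2) (s - 1) (ss_diff FF dd 2 (int r) (int s) \<zeta>)
    (\<lambda>x. mscale V ((-1) ^ r) (f (\<tau> (s - 1) x)))"
proof -
  obtain k where k: "s = Suc k" using s by (cases s) auto
  obtain x where x: "x \<in> \<zeta>" and f: "f = x r e \<circ> \<theta> s"
    using rep by (auto simp: represented_by_def)
  have xF: "x \<in> FF (int r) (int r + int s)" and dx: "dd (int r + int s) x \<in> FF (int r + 2) (int r + int s + 1)"
    using page_member(1)[OF \<zeta> x] by (simp_all add: ss_cycles_def)
  define a where "a = x r e"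
  define b where "b = x (Suc r) e"
  have xr: "x r \<in> entry (Suc k)" using FF_entry[OF xF, of r] by (simp add: k nat_add_distrib)
  have xr1: "x (Suc r) \<in> entry k" using FF_entry[OF xF, of "Suc r"] by (simp add: k)
  have a: "a \<in> khom (subgrp G M) (Y (Suc k)) V" unfolding a_def by (rule entry_val[OF xr])
  have b: "b \<in> khom (subgrp G M) (Y k) V" unfolding b_def by (rule entry_val[OF xr1])
  \<comment> \<open>Scaling by (-1)^i is undone by repeating it.\<close>
  have sign: "mscale V ((-1) ^ i) v = 0 \<longleftrightarrow> v = 0" for i v
    using kmod_scale_scale[OF V, of "(-1) ^ i" "(-1) ^ i" v] kmod_scale_one[OF V] kmod_scale_zero[OF V]
    by (auto simp: power_mult_distrib[symmetric])
  have coc: "a (dY (Suc (Suc k)) y) = 0" for y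
  proof -
    \<comment> \<open>Column r vanishes since d x has filtration r + 2; no horizontal term enters it
      since x has filtration r.\<close>
    have "dd (int r + int s) x r e y = 0" using FF_below[OF dx, of r] by simp
    moreover have "(if r = 0 then 0 else x (r - 1) (dZ r e) y) = 0"
      using FF_below[OF xF, of "r - 1"] by auto
    moreover have "nat (int r + int s - int r) + 1 = Suc (Suc k)" by (simp add: k)
    ultimately show ?thesis using sign by (simp add: lhs_diff_def a_def)
  qed
  have db: "if even r
      then maction V \<sigma> (a (maction (Y (Suc k)) \<gamma> y)) - a y - b (dY (Suc k) y) = 0
      else (\<Sum>i<q. maction V (\<sigma> [^] i) (a (maction (Y (Suc k)) (\<gamma> [^] i) y))) + b (dY (Suc k) y) = 0"
    if y: "y \<in> mcarrier (Y (Suc k))" for y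
  proof -
    \<comment> \<open>Column r + 1 vanishes as well. The parity of r + 1 decides between T - 1 and
      N.\<close>
    have "dd (int r + int s) x (Suc r) e y = 0" using FF_below[OF dx, of "Suc r"] by simp
    moreover have "nat (int r + int s - int (Suc r)) + 1 = Suc k" by (simp add: k)
    ultimately have "x r (dZ (Suc r) e) y + mscale V ((-1) ^ Suc r) (b (dY (Suc k) y)) = 0"
      by (simp add: lhs_diff_def b_def del: power_Suc)
    then show ?thesis
      using y entry_diff_odd[OF xr, of "Suc r"] entry_diff_even[OF xr, of "Suc r"]
      by (cases "even r") (auto simp: hom_kmod_def a_def[symmetric] \<gamma>_pow sum_fun_apply
          kmod_scale_one[OF V] kmod_scale_left_minus[OF V])
  qed
  obtain c where c: "c \<in> khom (subgrp G M) (Y k) V" and dc: "\<And>y. c (dY (Suc k) y) = 0"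
    and c\<tau>: "\<And>z. z \<in> mcarrier (P k) \<Longrightarrow> (if even r
      then \<Sum>i<q. maction V (\<sigma> [^] i) ((b - c) (maction (Y k) (\<gamma> [^] i) (\<theta> k z)))
      else maction V \<sigma> ((b - c) (maction (Y k) \<gamma> (\<theta> k z))) - (b - c) (\<theta> k z))
      = mscale V ((-1) ^ r) (a (\<theta> (Suc k) (\<tau> k z)))"
    using correction[OF a coc b db] by blast
  obtain X where X: "X \<in> entry k" "X e = c" using entry_exists[OF c] .
  define C where "C = (\<lambda>i. if i = Suc r then X else 0)"
  have C: "C \<in> ss_cycles FF dd 1 (int r + 1) (int k)"
    unfolding C_def by (rule cocycle_single[OF X(1)]) (simp add: X(2) dc)
  \<comment> \<open>The class is kept, while its component in column r + 1 changes from b to b - c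
    at the generator.\<close>
  define x' where "x' = x - C"
  have x': "x' \<in> \<zeta>"
    unfolding x'_def using page_diff_inner[OF \<zeta> x, of C] C by (simp add: k)
  have x'F: "x' \<in> FF (int r) (int r + int s)"
    using page_member(1)[OF \<zeta> x'] by (simp add: ss_cycles_def)
  have x'r1: "x' (Suc r) \<in> entry k" using FF_entry[OF x'F, of "Suc r"] by (simp add: k)
  have x'e: "x' (Suc r) e = b - c" by (simp add: x'_def C_def b_def X(2))
  have "dd (int r + int s) x' (r + 2) e \<circ> \<theta> k = (\<lambda>z. mscale V ((-1) ^ r) (f (\<tau> k z)))"
  proof
    fix z
    \<comment> \<open>The vertical term of column r + 2 dies after restriction along \<theta>: it
      becomes an M-homomorphism into V on a boundary of P. For k = 0 that column lies above the
      total degree.\<close>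
    have last: "x' (r + 2) e (dY (nat (int r + int s - int (r + 2)) + 1) (\<theta> k z)) = 0"
    proof (cases k)
      case 0
      then show ?thesis using FF_above[OF x'F, of "r + 2"] by (simp add: k)
    next
      case (Suc j)
      then have u: "x' (r + 2) e \<in> khom (subgrp G M) (Y j) V"
        using entry_val[OF FF_entry[OF x'F, of "r + 2"]] by (simp add: k)
      have n: "nat (int r + int s - int (r + 2)) + 1 = Suc j" by (simp add: k Suc)
      show ?thesis
      proof (cases "z \<in> mcarrier (P (Suc j))")
        case True
        then show ?thesis
          using \<theta>_chain[OF True] hom_trivial_boundary[OF khom_comp[OF \<theta>_khom u] True] by (simp only: n Suc)
      next
        case False
        then show ?thesis
          using khom_out[OF \<theta>_khom False] khom_zero[OF dY_khom] khom_zero[OF u] by (simp only: n Suc)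
      qed
    qed
    have "dd (int r + int s) x' (r + 2) e (\<theta> k z) = x' (Suc r) (dZ (r + 2) e) (\<theta> k z)"
      using last by (simp add: lhs_diff_def kmod_scale_zero[OF V])
    also have "\<dots> = mscale V ((-1) ^ r) (a (\<theta> (Suc k) (\<tau> k z)))"
    proof (cases "z \<in> mcarrier (P k)")
      case True
      then show ?thesis
        using c\<tau>[OF True] khom_mem[OF \<theta>_khom True] entry_diff_odd[OF x'r1, of "r + 2"] entry_diff_even[OF x'r1, of "r + 2"]
        by (cases "even r") (auto simp: hom_kmod_def x'e \<gamma>_pow sum_fun_apply)
    next
      case False
      then show ?thesis
        using khom_out[OF \<theta>_khom False] khom_out[OF \<tau> False] khom_zero[OF \<theta>_khom] khom_zero[OF a]
          khom_zero[OF entry_val[OF x'r1]] by (simp add: kmod_scale_zero[OF V])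
    qed
    finally show "(dd (int r + int s) x' (r + 2) e \<circ> \<theta> k) z = mscale V ((-1) ^ r) (f (\<tau> k z))"
      by (simp add: f a_def k)
  qed
  moreover have "dd (int r + int s) x' \<in> ss_diff FF dd 2 (int r) (int s) \<zeta>"
    by (rule diff_member[OF x'])
  moreover have "(\<lambda>x. mscale V ((-1) ^ r) (f (\<tau> k x))) \<in> khom (subgrp G M) (P k) V"
    using rep khom_mscale[OF khom_comp[OF \<tau>, of f k V] V_kmod_M] by (simp add: represented_by_def k)
  ultimately show ?thesis
    by (auto simp: represented_by_def k)
qed

end

text \<open>The image of a class is defined as a union of cosets; the first conjunct records that it
  is a single element of the second page.\<close>

theorem theoremA3:
  fixes G :: "('g, 'b) monoid_scheme"
    and M Q :: "'g set" and \<sigma> :: 'g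
    and p n r s :: nat
    and V :: "('k::field, 'g, 'v::ab_group_add) kmod"
    and P :: "nat \<Rightarrow> ('k, 'g, 'x::ab_group_add) kmod"
    and dP :: "nat \<Rightarrow> 'x \<Rightarrow> 'x" and \<epsilon>P :: "'x \<Rightarrow> 'k"
    and Y :: "nat \<Rightarrow> ('k, 'g, 'y::ab_group_add) kmod"
    and dY :: "nat \<Rightarrow> 'y \<Rightarrow> 'y" and \<epsilon>Y :: "'y \<Rightarrow> 'k"
    and \<theta> :: "nat \<Rightarrow> 'x \<Rightarrow> 'y"
    and \<alpha> \<tau> :: "nat \<Rightarrow> 'x \<Rightarrow> 'x"
    and f :: "'x \<Rightarrow> 'v"
    and \<zeta> :: "(nat \<Rightarrow> (unit \<times> 'g \<Rightarrow> 'k) \<Rightarrow> 'y \<Rightarrow> 'v) set"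
  assumes "prime p" and "odd p" and "n \<ge> 1" and "CHAR('k) = p"
    and "group G"
    and "\<sigma> \<in> carrier G" and "Q = generate G {\<sigma>}" and "card Q = p ^ n"
    and "M \<lhd> G" and "finite M" and "M \<inter> Q = {\<one>\<^bsub>G\<^esub>}" and "M <#>\<^bsub>G\<^esub> Q = carrier G"
    and "is_kmod G V" and "\<forall>h\<in>M. \<forall>v\<in>mcarrier V. maction V h v = v"
    and "minimal_projective_resolution (subgrp G M) P dP \<epsilon>P"
    and "projective_resolution G Y dY \<epsilon>Y"
    and "chain_map (subgrp G M) P dP Y dY \<theta>"
    and "\<forall>x\<in>mcarrier (P 0). \<epsilon>Y (\<theta> 0 x) = \<epsilon>P x"
    and "chain_map (subgrp G M) P dP (\<lambda>k. twist G (inv\<^bsub>G\<^esub> \<sigma>) (P k)) dP \<alpha>"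
    and "\<forall>x\<in>mcarrier (P 0). \<epsilon>P (\<alpha> 0 x) = \<epsilon>P x"
    and "\<forall>k. \<tau> k \<in> khom (subgrp G M) (P k) (P (k + 1))"
    and "\<forall>x\<in>mcarrier (P 0). dP 1 (\<tau> 0 x) = x - (\<alpha> 0 ^^ (p ^ n)) x"
    and "\<forall>k. \<forall>x\<in>mcarrier (P (k + 1)).
           dP (k + 2) (\<tau> (k + 1) x) + \<tau> k (dP (k + 1) x) = x - (\<alpha> (k + 1) ^^ (p ^ n)) x"
    and "s \<ge> 1"
    and "\<zeta> \<in> lhs_page G M \<sigma> Y dY V 2 (int r) (int s)"
    and "represented_by G M P V \<theta> r s \<zeta> f"
  shows "lhs_page_diff G M \<sigma> Y dY V 2 (int r) (int s) \<zeta>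
           \<in> lhs_page G M \<sigma> Y dY V 2 (int (r + 2)) (int (s - 1)) \<and>
         represented_by G M P V \<theta> (r + 2) (s - 1)
           (lhs_page_diff G M \<sigma> Y dY V 2 (int r) (int s) \<zeta>)
           (\<lambda>x. mscale V ((-1) ^ r) (f (\<tau> (s - 1) x)))"
proof -
  interpret group G by fact
  have q: "card (generate G {\<sigma>}) = p ^ n" using assms(7,8) by simp
  have projP: "projective_resolution (subgrp G M) P dP \<epsilon>P"
    using assms(15) by (simp add: minimal_projective_resolution_def)
  \<comment> \<open>The two hypotheses on \<tau> merge into one: in degree 0 the index k - 1 is
    truncated to 0, but \<tau> is then applied to 0.\<close>
  have \<tau>_homotopy: "dP (Suc k) (\<tau> k x) + \<tau> (k - 1) (dP k x) = x - (\<alpha> k ^^ card (generate G {\<sigma>})) x"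
    if "x \<in> mcarrier (P k)" for k x
  proof (cases k)
    case 0
    have "dP 0 = 0" using projP by (simp add: projective_resolution_def chain_complex_def)
    moreover have "\<tau> 0 0 = 0" using assms(21) khom_zero by blast
    ultimately show ?thesis using assms(22) that q by (simp add: 0)
  next
    case (Suc j)
    then show ?thesis using assms(23)[rule_format, of x j] that q by simp
  qed
  interpret lhs_core G M \<sigma> V Y dY \<epsilon>Y P dP \<epsilon>P \<theta> \<alpha> \<tau>
    by (intro lhs_core.intro lhs_data.intro lhs_data_axioms.intro lhs_core_axioms.intro)
      (use assms \<tau>_homotopy in simp_all)
  \<comment> \<open>The row s - 2 + 1 of the target agrees with the natural number s - 1 only
    because s \<ge> 1.\<close>
  have "int (r + 2) = int r + 2" "int (s - 1) = int s - 2 + 1" using \<open>s \<ge> 1\<close> by simp_all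
  then show ?thesis
    using diff_page[OF assms(25)] d2_represented[OF assms(24,25,26)] by (simp add: add.commute)
qed

end
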